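(* Every joint measurability hypergraph admits a quantum realization with POVMs. That is, let $(V,E)$ be a joint measurability hypergraph: $V$ is a set and $E$ is a family of finite subsets of $V$ such that $e\in E$ and $e'\subseteq e$ imply $e'\in E$, and such that $\{v\}\in E$ for every $v\in V$. Then there exist a complex Hilbert space $\mathcal{H}$ and, for each $v\in V$, a POVM $M_v$ on $\mathcal{H}$ such that for every nonempty finite subset $S\subseteq V$, the finite family $(M_v)_{v\in S}$ is jointly measurable if and only if $S\in E$.
   Context: A positive-operator valued measure (POVM) on a complex Hilbert space $\mathcal{H}$ with outcome set $X$ is a map $x\mapsto M(x)$ from $X$ to the bounded operators $\mathcal{B}(\mathcal{H})$ such that $M(x)\geq 0$ (positive semidefinite) for all $x\in X$ and $\sum_{x\in X}M(x)=I$. (If $X$ is infinite, sums are understood in the strong operator topology.) The outcome set may depend on the POVM. Joint measurability: a finite family of POVMs $M_1,\dots,M_N$ on the same Hilbert space $\mathcal{H}$, where $M_i$ has outcome set $X_i$, is called jointly measurable (or compatible) if there exists a POVM $M$ on $\mathcal{H}$ with outcome set $X_1\times\cdots\times X_N$ such that for each $i$ and each $x_i\in X_i$, $$M_i(x_i)=\sum_{x_1,\ldots,x_{i-1},x_{i+1},\ldots,x_N}M(x_1,\dots,x_N),$$ where the sum runs over all $x_j\in X_j$, $j\neq i$. Otherwise the family is called incompatible. A joint measurability hypergraph is an abstract simplicial complex: a vertex set $V$ together with a family $E$ of finite subsets of $V$ (called edges) that is closed under taking subsets and contains all singletons. Each vertex represents a POVM, and the edges represent the compatible finite sets of POVMs.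 A quantum realization of $(V,E)$ is an assignment of a POVM on a common Hilbert space to each vertex such that a finite set of vertices is an edge exactly when the assigned POVMs are jointly measurable. *)

theory Defs
  imports
    "HOL-Algebra.Module"
    "HOL-Analysis.Analysis"
begin

section \<open>Complex Hilbert spaces with an explicit carrier\<close>

text \<open>
  Carriers are explicit so that a Hilbert space can be existentially quantified. As usual for
  modules in HOL-Algebra, the fields \<^const>\<open>mult\<close> and \<^const>\<open>one\<close> of the record are unused.
\<close>

definition complex_ring :: "complex ring" where
  "complex_ring = \<lparr>carrier = UNIV, monoid.mult = (*), one = 1, ring.zero = 0, add = (+)\<rparr>"

record 'h inner_product_space = "(complex, 'h) module" +
  cinner :: "'h \<Rightarrow> 'h \<Rightarrow> complex"

definition cnorm :: "('h, 'm) inner_product_space_scheme \<Rightarrow> 'h \<Rightarrow> real" where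
  "cnorm H x = sqrt (Re (cinner H x x))"

text \<open>
  The case distinction is needed because \<^locale>\<open>Metric_space\<close> requires the distance to be
  nonnegative and symmetric also outside the carrier.
\<close>

definition cdist :: "('h, 'm) inner_product_space_scheme \<Rightarrow> 'h \<Rightarrow> 'h \<Rightarrow> real" where
  "cdist H x y =
     (if x \<in> carrier H \<and> y \<in> carrier H then cnorm H (x \<ominus>\<^bsub>H\<^esub> y) else 0)"

text \<open>The inner product is linear in its second argument.\<close>

locale complex_inner_product_space = Module.module complex_ring H
  for H :: "('h, 'm) inner_product_space_scheme" (structure) +
  assumes cinner_commute:
      "\<lbrakk>x \<in> carrier H; y \<in> carrier H\<rbrakk> \<Longrightarrow> cinner H x y = cnj (cinner H y x)"
    and cinner_add_right:
      "\<lbrakk>x \<in> carrier H; y \<in> carrier H; z \<in> carrier H\<rbrakk>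
        \<Longrightarrow> cinner H x (y \<oplus> z) = cinner H x y + cinner H x z"
    and cinner_smult_right:
      "\<lbrakk>x \<in> carrier H; y \<in> carrier H\<rbrakk> \<Longrightarrow> cinner H x (c \<odot> y) = c * cinner H x y"
    and cinner_nonneg: "x \<in> carrier H \<Longrightarrow> cinner H x x \<in> \<real>\<^sub>\<ge>\<^sub>0"
    and cinner_definite: "\<lbrakk>x \<in> carrier H; cinner H x x = 0\<rbrakk> \<Longrightarrow> x = \<zero>"

context complex_inner_product_space
begin

lemma complex_ring_simps:
  "carrier complex_ring = UNIV" "monoid.mult complex_ring = (*)" "one complex_ring = 1"
  "ring.zero complex_ring = 0" "ring.add complex_ring = (+)"
  by (auto simp: complex_ring_def)

lemma smult_carrier: "x \<in> carrier H \<Longrightarrow> c \<odot> x \<in> carrier H"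
  using smult_closed[of c x] by (simp add: complex_ring_def)

context
  notes [simp] = complex_ring_simps smult_carrier
begin

lemma minus_eq_smult: "x \<in> carrier H \<Longrightarrow> \<ominus> x = (-1) \<odot> x"
proof -
  assume x: "x \<in> carrier H"
  have "(-1) \<odot> x \<oplus> x = ((-1) + 1) \<odot> x" using smult_l_distr[of "-1" 1 x] smult_one[OF x] x by simp
  also have "\<dots> = \<zero>" using smult_l_null[OF x] by simp
  finally show ?thesis using x by (metis M.minus_equality smult_carrier)
qed

lemma cinner_self: "x \<in> carrier H \<Longrightarrow> Im (cinner H x x) = 0 \<and> Re (cinner H x x) \<ge> 0"
  using cinner_nonneg[of x] by (auto simp: nonneg_Reals_def)

lemma cinner_add_left:
  "\<lbrakk>x \<in> carrier H; y \<in> carrier H; z \<in> carrier H\<rbrakk>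
    \<Longrightarrow> cinner H (x \<oplus> y) z = cinner H x z + cinner H y z"
  by (metis cinner_commute cinner_add_right complex_cnj_add M.add.m_closed)

lemma cinner_smult_left:
  "\<lbrakk>x \<in> carrier H; y \<in> carrier H\<rbrakk> \<Longrightarrow> cinner H (c \<odot> x) y = cnj c * cinner H x y"
  by (metis cinner_commute cinner_smult_right complex_cnj_mult smult_carrier)

lemma cinner_line:
  assumes x: "x \<in> carrier H" and y: "y \<in> carrier H"
  shows "Re (cinner H (x \<oplus> of_real t \<odot> y) (x \<oplus> of_real t \<odot> y)) =
    Re (cinner H x x) + 2*t*Re (cinner H x y) + t^2 * Re (cinner H y y)"
  using x y cinner_self[OF y] cinner_commute[OF y x]
  by (simp add: cinner_add_left cinner_smult_left cinner_add_right cinner_smult_right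
      algebra_simps power2_eq_square)

lemma Re_cinner_le:
  assumes x: "x \<in> carrier H" and y: "y \<in> carrier H"
  shows "Re (cinner H x y) \<le> cnorm H x * cnorm H y"
proof -
  let ?a = "Re (cinner H x x)" and ?b = "Re (cinner H x y)" and ?c = "Re (cinner H y y)"
  have q: "0 \<le> ?a + 2*t*?b + t^2 * ?c" for t
    using cinner_line[OF x y, of t] cinner_self[of "x \<oplus> of_real t \<odot> y"] x y by simp
  have c: "?c \<ge> 0" "?a \<ge> 0" using cinner_self x y by auto
  have "?b^2 \<le> ?a * ?c"
  proof (cases "?c = 0")
    case True
    then have "y = \<zero>" using cinner_definite[OF y] cinner_self[OF y] by (simp add: complex_eq_iff)
    then have "y = 0 \<odot> y" using smult_l_null[OF y] by simp
    then have "cinner H x y = 0" using cinner_smult_right[OF x y, of 0] by simp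
    then show ?thesis using True by simp
  next
    case False
    then show ?thesis using q[of "-?b/?c"] c by (simp add: field_simps power2_eq_square)
  qed
  then have "\<bar>?b\<bar> \<le> sqrt (?a * ?c)" using real_sqrt_le_mono by fastforce
  then show ?thesis by (simp add: cnorm_def real_sqrt_mult)
qed

lemma cnorm_triangle:
  assumes x: "x \<in> carrier H" and y: "y \<in> carrier H"
  shows "cnorm H (x \<oplus> y) \<le> cnorm H x + cnorm H y"
proof -
  have "Re (cinner H (x \<oplus> y) (x \<oplus> y)) \<le> (cnorm H x + cnorm H y)^2"
    using cinner_line[OF x y, of 1] Re_cinner_le[OF x y] cinner_self x y smult_one[OF y]
    by (simp add: power2_sum cnorm_def)
  then show ?thesis unfolding cnorm_def[of H "x \<oplus> y"]
    using cinner_self x y by (intro real_le_lsqrt) (auto simp: cnorm_def)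
qed

lemma Metric_space_cdist: "Metric_space (carrier H) (cdist H)"
proof
  have nn: "cnorm H x \<ge> 0" if "x \<in> carrier H" for x
    using cinner_self[OF that] by (simp add: cnorm_def)
  show "0 \<le> cdist H x y" for x y by (simp add: cdist_def nn)
  have mn: "x \<ominus> y = (-1) \<odot> (y \<ominus> x)" if "x \<in> carrier H" "y \<in> carrier H" for x y
    using that minus_eq_smult[of "y \<ominus> x"] by (simp add: a_minus_def M.minus_add M.a_comm)
  show "cdist H x y = cdist H y x" for x y
    using mn[of x y] by (simp add: cdist_def cnorm_def cinner_smult_left cinner_smult_right)
  fix x y assume x: "x \<in> carrier H" and y: "y \<in> carrier H"
  have zz: "cinner H \<zero> \<zero> = 0"
    using cinner_add_right[of "\<zero>" "\<zero>" "\<zero>"] by simp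
  show "cdist H x y = 0 \<longleftrightarrow> x = y"
  proof
    assume "cdist H x y = 0"
    then have "cinner H (x \<ominus> y) (x \<ominus> y) = 0"
      using x y cinner_self[of "x \<ominus> y"] by (simp add: cdist_def cnorm_def complex_eq_iff)
    then have "x \<ominus> y = \<zero>" using cinner_definite x y by simp
    then show "x = y" using x y by (metis M.add.inv_closed M.minus_equality M.minus_minus a_minus_def)
  next
    assume "x = y" then show "cdist H x y = 0"
      using y zz by (simp add: cdist_def cnorm_def a_minus_def M.r_neg)
  qed
  fix z assume z: "z \<in> carrier H"
  have "x \<ominus> z = (x \<ominus> y) \<oplus> (y \<ominus> z)" using x y z
    by (simp add: a_minus_def M.a_assoc M.r_neg1)
  then show "cdist H x z \<le> cdist H x y + cdist H y z"
    using cnorm_triangle x y z by (simp add: cdist_def)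
qed

end

end

locale complex_hilbert_space = complex_inner_product_space +
  assumes complete: "Metric_space.mcomplete (carrier H) (cdist H)"

section \<open>Bounded operators and POVMs\<close>

text \<open>
  Operators are functions on the element type; only their restriction to the carrier matters.
\<close>

definition bounded_operator ::
    "('h, 'm) inner_product_space_scheme \<Rightarrow> ('h \<Rightarrow> 'h) \<Rightarrow> bool" where
  "bounded_operator H A \<longleftrightarrow>
     A \<in> carrier H \<rightarrow> carrier H \<and>
     (\<forall>x\<in>carrier H. \<forall>y\<in>carrier H. A (x \<oplus>\<^bsub>H\<^esub> y) = A x \<oplus>\<^bsub>H\<^esub> A y) \<and>
     (\<forall>c. \<forall>x\<in>carrier H. A (c \<odot>\<^bsub>H\<^esub> x) = c \<odot>\<^bsub>H\<^esub> A x) \<and>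
     (\<exists>K. \<forall>x\<in>carrier H. cnorm H (A x) \<le> K * cnorm H x)"

definition positive_operator ::
    "('h, 'm) inner_product_space_scheme \<Rightarrow> ('h \<Rightarrow> 'h) \<Rightarrow> bool" where
  "positive_operator H A \<longleftrightarrow>
     bounded_operator H A \<and> (\<forall>x\<in>carrier H. cinner H x (A x) \<in> \<real>\<^sub>\<ge>\<^sub>0)"

text \<open>\<open>\<Sum>i\<in>I. T i = A\<close> as an unordered sum in the strong operator topology.\<close>

definition has_strong_sum ::
    "('h, 'm) inner_product_space_scheme \<Rightarrow> ('i \<Rightarrow> 'h \<Rightarrow> 'h) \<Rightarrow> 'i set \<Rightarrow> ('h \<Rightarrow> 'h) \<Rightarrow> bool" where
  "has_strong_sum H T I A \<longleftrightarrow>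
     (\<forall>x\<in>carrier H.
        limitin (Metric_space.mtopology (carrier H) (cdist H))
          (\<lambda>F. \<Oplus>\<^bsub>H\<^esub>i\<in>F. T i x) (A x) (finite_subsets_at_top I))"

definition povm ::
    "('h, 'm) inner_product_space_scheme \<Rightarrow> 'x set \<Rightarrow> ('x \<Rightarrow> 'h \<Rightarrow> 'h) \<Rightarrow> bool" where
  "povm H \<Omega> M \<longleftrightarrow> (\<forall>x\<in>\<Omega>. positive_operator H (M x)) \<and> has_strong_sum H M \<Omega> (\<lambda>x. x)"

text \<open>
  The family of POVMs \<open>M i\<close> with outcome sets \<open>\<Omega> i\<close>, for \<open>i \<in> S\<close>. The product of the outcome
  sets is the extensional product \<open>PiE S \<Omega>\<close>.
\<close>

definition jointly_measurable ::
    "('h, 'm) inner_product_space_scheme \<Rightarrow> 'i set \<Rightarrow> ('i \<Rightarrow> 'x set) \<Rightarrow>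
      ('i \<Rightarrow> 'x \<Rightarrow> 'h \<Rightarrow> 'h) \<Rightarrow> bool" where
  "jointly_measurable H S \<Omega> M \<longleftrightarrow>
     (\<exists>G. povm H (PiE S \<Omega>) G \<and>
        (\<forall>i\<in>S. \<forall>x\<in>\<Omega> i. has_strong_sum H G {f \<in> PiE S \<Omega>. f i = x} (M i x)))"

section \<open>Joint measurability hypergraphs\<close>

definition joint_measurability_hypergraph :: "'v set \<Rightarrow> 'v set set \<Rightarrow> bool" where
  "joint_measurability_hypergraph V E \<longleftrightarrow>
     (\<forall>e\<in>E. finite e \<and> e \<subseteq> V) \<and>
     (\<forall>e\<in>E. \<forall>e'. e' \<subseteq> e \<longrightarrow> e' \<in> E) \<and>
     (\<forall>v\<in>V. {v} \<in> E)"

definition quantum_realization ::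
    "'v set \<Rightarrow> 'v set set \<Rightarrow> ('h, 'm) inner_product_space_scheme \<Rightarrow> ('v \<Rightarrow> 'x set) \<Rightarrow>
      ('v \<Rightarrow> 'x \<Rightarrow> 'h \<Rightarrow> 'h) \<Rightarrow> bool" where
  "quantum_realization V E H \<Omega> M \<longleftrightarrow>
     complex_hilbert_space H \<and>
     (\<forall>v\<in>V. povm H (\<Omega> v) (M v)) \<and>
     (\<forall>S. finite S \<and> S \<noteq> {} \<and> S \<subseteq> V \<longrightarrow> (jointly_measurable H S \<Omega> M \<longleftrightarrow> S \<in> E))"

end

theory Submission
  imports Defs
begin

text \<open>
  The Hilbert space is a direct sum of blocks indexed by the finite non-edges \<open>N\<close>. On the block
  of \<open>N\<close>, with \<open>n = card N\<close>, the vertices \<open>v \<in> N\<close> act by anticommuting self-adjoint unitaries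
  \<open>C\<^sub>v\<close>, and \<open>M\<^sub>v(\<plusminus>) = (I \<plusminus> \<eta> C\<^sub>v) / 2\<close> with \<open>\<eta> = 1 / sqrt (n - 1)\<close>; the other vertices
  get fair coins. A signed sum of \<open>k\<close> of the \<open>C\<^sub>v\<close> squares to \<open>k\<close>, so it has norm \<open>sqrt k\<close>.
  Hence \<open>(I + \<eta> (\<Sum>v. \<epsilon>\<^sub>v C\<^sub>v)) / 2 ^ k\<close> is positive for \<open>k < n\<close>, and these operators form a joint
  observable of any \<open>k\<close> vertices of \<open>N\<close>. An edge contains no non-edge, so it meets every \<open>N\<close> in a
  proper subset. Conversely, a joint observable \<open>G\<close> of all of \<open>N\<close> gives, for the normalised trace
  on the block, \<open>n \<eta> = (\<Sum>\<epsilon>. tr (G(\<epsilon>) (\<Sum>v. \<epsilon>\<^sub>v C\<^sub>v))) \<le> sqrt n\<close>, which the choice of \<open>\<eta>\<close> excludes.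
\<close>

section \<open>The Hilbert space of square-summable functions\<close>

definition l2_space :: "('i \<Rightarrow> complex) inner_product_space" where
  "l2_space = \<lparr>carrier = {x. (\<lambda>i. (cmod (x i))\<^sup>2) summable_on UNIV},
     monoid.mult = (\<lambda>x y. x), one = (\<lambda>i. 0), ring.zero = (\<lambda>i. 0), add = (\<lambda>x y i. x i + y i),
     module.smult = (\<lambda>c x i. c * x i), cinner = (\<lambda>x y. \<Sum>\<^sub>\<infinity>i. cnj (x i) * y i)\<rparr>"

lemma l2_simps [simp]:
  "ring.zero l2_space = (\<lambda>i. 0)" "add l2_space = (\<lambda>x y i. x i + y i)"
  "module.smult l2_space = (\<lambda>c x i. c * x i)"
  by (simp_all add: l2_space_def)

lemma cinner_l2: "cinner l2_space x y = (\<Sum>\<^sub>\<infinity>i. cnj (x i) * y i)"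
  by (simp add: l2_space_def)

lemma l2_carrier: "x \<in> carrier l2_space \<longleftrightarrow> (\<lambda>i. (cmod (x i))\<^sup>2) summable_on UNIV"
  by (simp add: l2_space_def)

lemma cring_complex_ring: "cring complex_ring"
proof (rule cringI)
  show "abelian_group complex_ring"
    by (rule abelian_groupI) (auto simp: complex_ring_def intro: exI[of _ "- x" for x])
  show "comm_monoid complex_ring"
    by (rule comm_monoidI) (auto simp: complex_ring_def)
qed (auto simp: complex_ring_def algebra_simps)

lemma complex_ring_ops:
  "one complex_ring = 1" "ring.add complex_ring = (+)" "monoid.mult complex_ring = (*)"
  by (auto simp: complex_ring_def)

lemma l2_summable_mult:
  assumes "x \<in> carrier l2_space" "y \<in> carrier l2_space"
  shows "(\<lambda>i. cmod (x i) * cmod (y i)) summable_on UNIV"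
proof (rule summable_on_comparison_test)
  show "(\<lambda>i. (cmod (x i))\<^sup>2 + (cmod (y i))\<^sup>2) summable_on UNIV"
    using assms by (auto simp: l2_carrier intro: summable_on_add)
  show "cmod (x i) * cmod (y i) \<le> (cmod (x i))\<^sup>2 + (cmod (y i))\<^sup>2" for i
  proof -
    have "0 \<le> cmod (x i) * cmod (y i)" by simp
    then show ?thesis
      using sum_squares_bound[of "cmod (x i)" "cmod (y i)"] unfolding mult.assoc by linarith
  qed
qed auto

lemma l2_summable_cinner:
  assumes "x \<in> carrier l2_space" "y \<in> carrier l2_space"
  shows "(\<lambda>i. cnj (x i) * y i) summable_on UNIV"
  by (rule abs_summable_summable) (use l2_summable_mult[OF assms] in \<open>simp add: norm_mult\<close>)

lemma l2_add_closed:
  assumes "x \<in> carrier l2_space" "y \<in> carrier l2_space"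
  shows "(\<lambda>i. x i + y i) \<in> carrier l2_space"
  unfolding l2_carrier
proof (rule summable_on_comparison_test)
  show "(\<lambda>i. 2 * (cmod (x i))\<^sup>2 + 2 * (cmod (y i))\<^sup>2) summable_on UNIV"
    using assms by (auto simp: l2_carrier intro!: summable_on_add summable_on_cmult_right)
  show "(cmod (x i + y i))\<^sup>2 \<le> 2 * (cmod (x i))\<^sup>2 + 2 * (cmod (y i))\<^sup>2" for i
  proof -
    have "(cmod (x i + y i))\<^sup>2 \<le> (cmod (x i) + cmod (y i))\<^sup>2"
      by (intro power_mono norm_triangle_ineq) auto
    then show ?thesis
      using sum_squares_bound[of "cmod (x i)" "cmod (y i)"] by (simp add: power2_sum)
  qed
qed auto

lemma l2_smult_closed: "x \<in> carrier l2_space \<Longrightarrow> (\<lambda>i. c * x i) \<in> carrier l2_space"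
  by (auto simp: l2_carrier norm_mult power_mult_distrib intro: summable_on_cmult_right)

lemma l2_scaleR_closed: "x \<in> carrier l2_space \<Longrightarrow> (\<lambda>i. (r::real) *\<^sub>R x i) \<in> carrier l2_space"
  using l2_smult_closed[of x "of_real r"] by (simp add: scaleR_conv_of_real)

lemma l2_zero_closed: "(\<lambda>i. 0) \<in> carrier l2_space"
  by (simp add: l2_carrier)

lemma l2_sum_closed:
  "\<lbrakk>finite F; \<And>j. j \<in> F \<Longrightarrow> g j \<in> carrier l2_space\<rbrakk> \<Longrightarrow> (\<lambda>i. \<Sum>j\<in>F. g j i) \<in> carrier l2_space"
  by (induction F rule: finite_induct) (auto intro: l2_zero_closed l2_add_closed)

lemma abelian_group_l2: "abelian_group (l2_space :: ('i \<Rightarrow> complex) inner_product_space)"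
proof (rule abelian_groupI)
  fix x :: "'i \<Rightarrow> complex" assume x: "x \<in> carrier l2_space"
  then show "\<exists>y\<in>carrier l2_space. y \<oplus>\<^bsub>l2_space\<^esub> x = \<zero>\<^bsub>l2_space\<^esub>"
    using l2_smult_closed[OF x, of "-1"] by (intro bexI[of _ "\<lambda>i. -1 * x i"]) auto
qed (auto simp: l2_add_closed l2_zero_closed)

lemma cinner_l2_self:
  assumes "x \<in> carrier l2_space"
  shows "cinner l2_space x x = of_real (\<Sum>\<^sub>\<infinity>i. (cmod (x i))\<^sup>2)"
  unfolding cinner_l2
proof (rule infsumI)
  have "((\<lambda>i. complex_of_real ((cmod (x i))\<^sup>2)) has_sum of_real (\<Sum>\<^sub>\<infinity>i. (cmod (x i))\<^sup>2)) UNIV"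
    using assms by (intro has_sum_of_real has_sum_infsum) (simp add: l2_carrier)
  then show "((\<lambda>i. cnj (x i) * x i) has_sum of_real (\<Sum>\<^sub>\<infinity>i. (cmod (x i))\<^sup>2)) UNIV"
    by (simp only: complex_norm_square mult.commute)
qed

lemma cnorm_l2: "x \<in> carrier l2_space \<Longrightarrow> cnorm l2_space x = sqrt (\<Sum>\<^sub>\<infinity>i. (cmod (x i))\<^sup>2)"
  by (simp add: cnorm_def cinner_l2_self)

lemma cinner_l2_add:
  assumes "x \<in> carrier l2_space" "y \<in> carrier l2_space" "z \<in> carrier l2_space"
  shows "cinner l2_space x (\<lambda>i. y i + z i) = cinner l2_space x y + cinner l2_space x z"
  unfolding cinner_l2 ring_distribs
  by (rule infsum_add) (simp_all add: l2_summable_cinner assms)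

lemma complex_inner_product_space_l2:
  "complex_inner_product_space (l2_space :: ('i \<Rightarrow> complex) inner_product_space)"
proof (intro complex_inner_product_space.intro complex_inner_product_space_axioms.intro)
  show "Module.module complex_ring (l2_space :: ('i \<Rightarrow> complex) inner_product_space)"
    by (rule moduleI) (auto simp: cring_complex_ring abelian_group_l2 l2_smult_closed
        complex_ring_ops algebra_simps)
  fix x y z :: "'i \<Rightarrow> complex" and c
  assume x: "x \<in> carrier l2_space"
  show "cinner l2_space x x \<in> \<real>\<^sub>\<ge>\<^sub>0"
    using x by (simp add: cinner_l2_self infsum_nonneg)
  show "x = \<zero>\<^bsub>l2_space\<^esub>" if "cinner l2_space x x = 0"
  proof -
    have "(\<Sum>\<^sub>\<infinity>i. (cmod (x i))\<^sup>2) = 0" using that x by (simp add: cinner_l2_self)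
    then have "(cmod (x i))\<^sup>2 = 0" for i
      using nonneg_infsum_le_0D[of "\<lambda>i. (cmod (x i))\<^sup>2" UNIV i] x by (simp add: l2_carrier)
    then show ?thesis by (simp add: fun_eq_iff)
  qed
  assume y: "y \<in> carrier l2_space"
  have "cnj (cinner l2_space y x) = (\<Sum>\<^sub>\<infinity>i. cnj (cnj (y i) * x i))"
    unfolding cinner_l2 by (rule infsum_cnj[symmetric])
  then show "cinner l2_space x y = cnj (cinner l2_space y x)"
    by (simp add: cinner_l2 mult.commute)
  have "cinner l2_space x (\<lambda>i. c * y i) = (\<Sum>\<^sub>\<infinity>i. c * (cnj (x i) * y i))"
    by (simp add: cinner_l2 algebra_simps)
  then show "cinner l2_space x (c \<odot>\<^bsub>l2_space\<^esub> y) = c * cinner l2_space x y"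
    by (simp add: infsum_cmult_right' cinner_l2)
  assume z: "z \<in> carrier l2_space"
  show "cinner l2_space x (y \<oplus>\<^bsub>l2_space\<^esub> z) = cinner l2_space x y + cinner l2_space x z"
    using cinner_l2_add[OF x y z] by simp
qed

lemma l2_minus:
  assumes "x \<in> carrier l2_space" "y \<in> carrier l2_space"
  shows "x \<ominus>\<^bsub>l2_space\<^esub> y = (\<lambda>i. x i - y i)"
proof -
  interpret complex_inner_product_space l2_space by (rule complex_inner_product_space_l2)
  show ?thesis using assms minus_eq_smult[of y] by (auto simp: a_minus_def)
qed

lemma l2_diff_closed:
  assumes "x \<in> carrier l2_space" "y \<in> carrier l2_space"
  shows "(\<lambda>i. x i - y i) \<in> carrier l2_space"
  using l2_add_closed[OF assms(1) l2_smult_closed[OF assms(2), of "-1"]] by simp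

lemma cdist_l2:
  assumes "x \<in> carrier l2_space" "y \<in> carrier l2_space"
  shows "cdist l2_space x y = sqrt (\<Sum>\<^sub>\<infinity>i. (cmod (x i - y i))\<^sup>2)"
  using assms by (simp add: cdist_def l2_minus cnorm_l2 l2_diff_closed)

text \<open>A Cauchy sequence converges coordinatewise. The Cauchy bound on finitely many
  coordinates passes to that limit, uniformly in the finite set, which gives both membership of the
  limit and convergence in norm.\<close>

lemma complex_hilbert_space_l2:
  "complex_hilbert_space (l2_space :: ('i \<Rightarrow> complex) inner_product_space)"
proof -
  let ?H = "l2_space :: ('i \<Rightarrow> complex) inner_product_space"
  interpret complex_inner_product_space ?H by (rule complex_inner_product_space_l2)
  interpret M: Metric_space "carrier ?H" "cdist ?H" by (rule Metric_space_cdist)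
  have "M.mcomplete"
    unfolding M.mcomplete_def
  proof (intro allI impI)
    fix \<sigma> assume "M.MCauchy \<sigma>"
    then have car: "\<And>n. \<sigma> n \<in> carrier ?H"
      and cau: "\<And>e. e > 0 \<Longrightarrow> \<exists>N. \<forall>n m. N \<le> n \<longrightarrow> N \<le> m \<longrightarrow> cdist ?H (\<sigma> n) (\<sigma> m) < e"
      by (auto simp: M.MCauchy_def)
    have fin: "(\<Sum>i\<in>F. (cmod (\<sigma> n i - \<sigma> m i))\<^sup>2) \<le> (cdist ?H (\<sigma> n) (\<sigma> m))\<^sup>2" if "finite F" for F n m
    proof -
      have "(\<Sum>i\<in>F. (cmod (\<sigma> n i - \<sigma> m i))\<^sup>2) \<le> (\<Sum>\<^sub>\<infinity>i. (cmod (\<sigma> n i - \<sigma> m i))\<^sup>2)"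
        using l2_diff_closed[OF car car, of n m] that
        by (intro finite_sum_le_infsum) (auto simp: l2_carrier)
      then show ?thesis by (simp add: cdist_l2 car infsum_nonneg)
    qed
    have ptw: "cmod (\<sigma> n i - \<sigma> m i) \<le> cdist ?H (\<sigma> n) (\<sigma> m)" for n m i
      using fin[of "{i}" n m] by (auto intro: power2_le_imp_le)
    have "Cauchy (\<lambda>n. \<sigma> n i)" for i
    proof (rule metric_CauchyI)
      fix e :: real assume "e > 0"
      then obtain N where "\<And>n m. N \<le> n \<Longrightarrow> N \<le> m \<Longrightarrow> cdist ?H (\<sigma> n) (\<sigma> m) < e"
        using cau by blast
      then have "dist (\<sigma> m i) (\<sigma> n i) < e" if "m \<ge> N" "n \<ge> N" for m n
        using ptw[of m i n] that unfolding dist_norm by (meson le_less_trans)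
      then show "\<exists>N. \<forall>m\<ge>N. \<forall>n\<ge>N. dist (\<sigma> m i) (\<sigma> n i) < e" by blast
    qed
    then have x: "(\<lambda>n. \<sigma> n i) \<longlonglongrightarrow> lim (\<lambda>n. \<sigma> n i)" for i
      by (simp add: Cauchy_convergent_iff convergent_LIMSEQ_iff)
    define x where "x i = lim (\<lambda>n. \<sigma> n i)" for i
    note x = x[folded x_def]
    \<comment> \<open>The index \<open>N\<close> is chosen before \<open>F\<close>, so the bound
      survives the supremum over all finite sets of coordinates.\<close>
    have key: "\<exists>N. \<forall>n\<ge>N. \<forall>F. finite F \<longrightarrow> (\<Sum>i\<in>F. (cmod (\<sigma> n i - x i))\<^sup>2) \<le> e\<^sup>2" if e: "e > 0" for e
    proof -
      obtain N where N: "\<And>n m. N \<le> n \<Longrightarrow> N \<le> m \<Longrightarrow> cdist ?H (\<sigma> n) (\<sigma> m) < e"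
        using cau[OF e] by blast
      have "(\<Sum>i\<in>F. (cmod (\<sigma> n i - x i))\<^sup>2) \<le> e\<^sup>2" if n: "n \<ge> N" and F: "finite F" for n F
      proof (rule LIMSEQ_le_const2)
        show "(\<lambda>m. \<Sum>i\<in>F. (cmod (\<sigma> n i - \<sigma> m i))\<^sup>2) \<longlonglongrightarrow> (\<Sum>i\<in>F. (cmod (\<sigma> n i - x i))\<^sup>2)"
          by (intro tendsto_intros x)
        have "(\<Sum>i\<in>F. (cmod (\<sigma> n i - \<sigma> m i))\<^sup>2) \<le> e\<^sup>2" if "m \<ge> N" for m
          using fin[OF F, of n m] power_mono[of "cdist ?H (\<sigma> n) (\<sigma> m)" e 2] N[OF n that] by force
        then show "\<exists>N. \<forall>m\<ge>N. (\<Sum>i\<in>F. (cmod (\<sigma> n i - \<sigma> m i))\<^sup>2) \<le> e\<^sup>2" by blast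
      qed
      then show ?thesis by blast
    qed
    have diff: "(\<lambda>i. \<sigma> n i - x i) \<in> carrier ?H"
      if "\<And>F. finite F \<Longrightarrow> (\<Sum>i\<in>F. (cmod (\<sigma> n i - x i))\<^sup>2) \<le> C" for n C
      unfolding l2_carrier
      by (rule nonneg_bdd_above_summable_on) (auto intro!: bdd_aboveI[of _ C] that)
    obtain n0 where "\<And>F. finite F \<Longrightarrow> (\<Sum>i\<in>F. (cmod (\<sigma> n0 i - x i))\<^sup>2) \<le> 1\<^sup>2"
      using key[of 1] by auto
    from l2_diff_closed[OF car[of n0] diff[OF this]] have xc: "x \<in> carrier ?H" by simp
    have "\<exists>N. \<forall>n\<ge>N. cdist ?H (\<sigma> n) x < e" if e: "e > 0" for e
    proof -
      \<comment> \<open>Only a weak inequality passes to the limit; \<open>e/2\<close> leaves room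
        for the strict one.\<close>
      obtain N where N: "\<And>n F. n \<ge> N \<Longrightarrow> finite F \<Longrightarrow> (\<Sum>i\<in>F. (cmod (\<sigma> n i - x i))\<^sup>2) \<le> (e/2)\<^sup>2"
        using key[of "e/2"] e by auto
      have "cdist ?H (\<sigma> n) x \<le> e/2" if "n \<ge> N" for n
        unfolding cdist_l2[OF car xc] using e N[OF that] l2_diff_closed[OF car xc, of n]
        by (intro real_le_lsqrt infsum_le_finite_sums) (auto simp: l2_carrier infsum_nonneg)
      then have "\<forall>n\<ge>N. cdist ?H (\<sigma> n) x < e" using e by fastforce
      then show ?thesis by blast
    qed
    then have "limitin M.mtopology \<sigma> x sequentially"
      unfolding M.limit_metric_sequentially using xc car by auto
    then show "\<exists>x. limitin M.mtopology \<sigma> x sequentially" by blast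
  qed
  then show ?thesis by unfold_locales
qed

section \<open>Strong sums over finite index sets\<close>

lemma finsum_l2:
  assumes "finite F" "\<And>j. j \<in> F \<Longrightarrow> g j \<in> carrier l2_space"
  shows "(\<Oplus>\<^bsub>l2_space\<^esub>j\<in>F. g j) = (\<lambda>i. \<Sum>j\<in>F. g j i)"
proof -
  interpret abelian_group l2_space by (rule abelian_group_l2)
  show ?thesis using assms
    by (induction F rule: finite_induct) (auto simp: finsum_insert finsum_empty Pi_def)
qed

text \<open>For finite \<open>I\<close> the net of partial sums is eventually constant, and limits
  are unique in a metric space. All outcome sets below are finite, so every strong sum reduces to a
  pointwise identity.\<close>

lemma has_strong_sum_l2_finite:
  assumes "finite I" "\<And>i x. \<lbrakk>i \<in> I; x \<in> carrier l2_space\<rbrakk> \<Longrightarrow> T i x \<in> carrier l2_space"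
  shows "has_strong_sum l2_space T I A \<longleftrightarrow>
    (\<forall>x\<in>carrier l2_space. A x = (\<lambda>p. \<Sum>i\<in>I. T i x p))"
proof -
  let ?H = "l2_space :: ('b \<Rightarrow> complex) inner_product_space"
  interpret complex_inner_product_space ?H by (rule complex_inner_product_space_l2)
  interpret M: Metric_space "carrier ?H" "cdist ?H" by (rule Metric_space_cdist)
  have "limitin M.mtopology (\<lambda>F. \<Oplus>\<^bsub>?H\<^esub>i\<in>F. T i x) (A x) (finite_subsets_at_top I) \<longleftrightarrow>
      A x = (\<lambda>p. \<Sum>i\<in>I. T i x p)" (is "limitin _ ?f _ _ \<longleftrightarrow> _ = ?s") if x: "x \<in> carrier ?H" for x
  proof -
    have s: "?f I = ?s" by (rule finsum_l2) (use assms x in auto)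
    have "?s \<in> carrier ?H" by (rule l2_sum_closed) (use assms x in auto)
    then have lim: "limitin M.mtopology ?f ?s (finite_subsets_at_top I)"
      by (intro limitin_eventually)
        (simp_all add: eventually_finite_subsets_at_top_finite[OF assms(1)] s)
    then show ?thesis
      using limitin_Hausdorff_unique[OF lim _ _ M.Hausdorff_space_mtopology]
      by (metis finite_subsets_at_top_neq_bot)
  qed
  then show ?thesis unfolding has_strong_sum_def by simp
qed

section \<open>Clifford generators on blocks\<close>

text \<open>The sign of the Jordan--Wigner transformation: the \<open>j\<close>-th generator flips bit \<open>j\<close> of the basis
  label \<open>k\<close> and multiplies by the parity of the bits below \<open>j\<close>.\<close>

primrec jw_sign :: "nat \<Rightarrow> nat \<Rightarrow> real" where
  "jw_sign 0 k = 1"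
| "jw_sign (Suc j) k = (if bit k j then -1 else 1) * jw_sign j k"

lemma jw_sign_mult_self [simp]: "jw_sign j k * jw_sign j k = 1"
  by (induction j) auto

text \<open>Bit \<open>i\<close> enters the parity exactly when \<open>i < j\<close>. For two
  distinct generators, exactly one of the two therefore sees the flip made by the other, which is
  the source of anticommutation.\<close>

lemma jw_sign_flip_bit: "jw_sign j (flip_bit i k) = (if i < j then - jw_sign j k else jw_sign j k)"
  by (induction j) (auto simp: bit_flip_bit_iff less_Suc_eq)

lemma flip_bit_flip_bit [simp]: "flip_bit i (flip_bit i k) = (k::nat)"
  by (rule bit_eqI) (auto simp: bit_flip_bit_iff)

lemma flip_bit_commute: "flip_bit i (flip_bit j k) = flip_bit j (flip_bit i (k::nat))"
  by (rule bit_eqI) (auto simp: bit_flip_bit_iff)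

text \<open>The labels below \<open>2 ^ n\<close> form an invariant set of the first
  \<open>n\<close> generators, so traces can be taken over finitely many labels although a block
  carries all of \<open>nat\<close>.\<close>

lemma flip_bit_less_power: "\<lbrakk>i < n; k < 2 ^ n\<rbrakk> \<Longrightarrow> flip_bit i (k::nat) < 2 ^ n"
  by (metis take_bit_flip_bit_eq take_bit_nat_eq_self_iff not_le)

text \<open>Junk value: for \<open>card N \<le> 1\<close> the division by zero gives \<open>0\<close>, a trivial block.\<close>

definition block_scale :: "'v set set \<Rightarrow> 'v set \<Rightarrow> real" where
  "block_scale E N = (if finite N \<and> N \<notin> E then 1 / sqrt (real (card N - 1)) else 0)"

text \<open>The scale \<eta> is built in, so the operator below is \<eta> times a reflection. Every
  set labels a block; on edges and infinite sets \<open>block_scale\<close> is \<open>0\<close>, and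
  there all vertices become fair coins. \<open>to_nat_on\<close> numbers the vertices of a finite
  block.\<close>

definition clifford_weight :: "'v set set \<Rightarrow> 'v \<Rightarrow> 'v set \<times> nat \<Rightarrow> real" where
  "clifford_weight E v p =
     (if v \<in> fst p then block_scale E (fst p) * jw_sign (to_nat_on (fst p) v) (snd p) else 0)"

definition clifford_flip :: "'v \<Rightarrow> 'v set \<times> nat \<Rightarrow> 'v set \<times> nat" where
  "clifford_flip v p = (fst p, flip_bit (to_nat_on (fst p) v) (snd p))"

definition clifford ::
    "'v set set \<Rightarrow> 'v \<Rightarrow> ('v set \<times> nat \<Rightarrow> complex) \<Rightarrow> 'v set \<times> nat \<Rightarrow> complex" where
  "clifford E v x p = clifford_weight E v p *\<^sub>R x (clifford_flip v p)"

lemma clifford_flip_flip [simp]: "clifford_flip v (clifford_flip v p) = p"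
  by (simp add: clifford_flip_def)

lemma clifford_flip_commute: "clifford_flip v (clifford_flip w p) = clifford_flip w (clifford_flip v p)"
  by (simp add: clifford_flip_def flip_bit_commute)

lemma bij_clifford_flip: "bij (clifford_flip v)"
  by (rule o_bij[of "clifford_flip v"]) (auto simp: fun_eq_iff)

lemma clifford_weight_flip_self [simp]:
  "clifford_weight E v (clifford_flip v p) = clifford_weight E v p"
  by (simp add: clifford_weight_def clifford_flip_def jw_sign_flip_bit)

text \<open>Anticommutation at the level of weights. If the block is infinite or misses
  \<open>v\<close> or \<open>w\<close>, a weight is zero throughout the block and the sign can be
  chosen freely.\<close>

lemma clifford_weight_flip:
  assumes "v \<noteq> w"
  shows "clifford_weight E v (clifford_flip w p) = clifford_weight E v p \<and>
      clifford_weight E w (clifford_flip v p) = - clifford_weight E w p \<or>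
    clifford_weight E v (clifford_flip w p) = - clifford_weight E v p \<and>
      clifford_weight E w (clifford_flip v p) = clifford_weight E w p"
proof (cases "finite (fst p) \<and> v \<in> fst p \<and> w \<in> fst p")
  case True
  then have "to_nat_on (fst p) v \<noteq> to_nat_on (fst p) w"
    using assms to_nat_on_inj[of "fst p" v w] countable_finite by blast
  then show ?thesis
    by (auto simp: clifford_weight_def clifford_flip_def jw_sign_flip_bit)
next
  case False
  then show ?thesis
    by (auto simp: clifford_weight_def clifford_flip_def block_scale_def jw_sign_flip_bit)
qed

lemma clifford_weight_square:
  "(clifford_weight E v p)\<^sup>2 = (if v \<in> fst p then (block_scale E (fst p))\<^sup>2 else 0)"
  by (simp add: clifford_weight_def power2_eq_square)

text \<open>If the edge \<open>S\<close> contained a non-edge \<open>?N\<close>, then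
  \<open>?N\<close> would be an edge by downward closure. So \<open>S\<close> meets
  \<open>?N\<close> in at most \<open>card ?N - 1\<close> vertices, each contributing
  \<open>1 / (card ?N - 1)\<close>.\<close>

lemma sum_clifford_weight_square_le:
  assumes E: "\<And>e e'. \<lbrakk>e \<in> E; e' \<subseteq> e\<rbrakk> \<Longrightarrow> e' \<in> E" and S: "S \<in> E" "finite S"
  shows "(\<Sum>v\<in>S. (clifford_weight E v p)\<^sup>2) \<le> 1"
proof -
  let ?N = "fst p"
  have "(\<Sum>v\<in>S. (clifford_weight E v p)\<^sup>2) = real (card (S \<inter> ?N)) * (block_scale E ?N)\<^sup>2"
    using S(2) by (simp add: clifford_weight_square sum.If_cases)
  also have "\<dots> \<le> 1"
  proof (cases "finite ?N \<and> ?N \<notin> E")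
    case True
    then have "S \<inter> ?N \<subset> ?N" using E[OF S(1), of ?N] by blast
    then have "card (S \<inter> ?N) < card ?N" using True by (simp add: psubset_card_mono)
    then have "real (card (S \<inter> ?N)) \<le> real (card ?N - 1)" by simp
    \<comment> \<open>For a one-element \<open>?N\<close> the denominator is \<open>0\<close> and
      the quotient is \<open>0\<close> by convention, so the bound still holds.\<close>
    then have "real (card (S \<inter> ?N)) * (1 / real (card ?N - 1)) \<le> 1"
      by (cases "real (card ?N - 1) = 0") (auto simp: divide_simps)
    then show ?thesis using True by (simp add: block_scale_def power_divide)
  qed (auto simp: block_scale_def)
  finally show ?thesis .
qed

lemma clifford_weight_le: "\<bar>clifford_weight E v p\<bar> \<le> 1"
proof -
  have "(block_scale E (fst p))\<^sup>2 \<le> 1"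
    by (cases "card (fst p) - 1 = 0") (auto simp: block_scale_def power_divide)
  then have "(clifford_weight E v p)\<^sup>2 \<le> 1" by (simp add: clifford_weight_square)
  then show ?thesis by (simp add: abs_square_le_1)
qed

section \<open>Generators as self-adjoint operators on the whole space\<close>

lemma clifford_closed:
  assumes "x \<in> carrier l2_space" shows "clifford E v x \<in> carrier l2_space"
  unfolding l2_carrier
proof (rule summable_on_comparison_test)
  show "(\<lambda>p. (cmod (x (clifford_flip v p)))\<^sup>2) summable_on UNIV"
    using assms summable_on_reindex_bij_betw[OF bij_clifford_flip, of "\<lambda>p. (cmod (x p))\<^sup>2" v]
    by (simp add: l2_carrier)
  show "(cmod (clifford E v x p))\<^sup>2 \<le> (cmod (x (clifford_flip v p)))\<^sup>2" for p
    using clifford_weight_le[of E v p] by (auto simp: clifford_def mult_left_le_one_le)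
qed auto

text \<open>Reindex by the flip of \<open>v\<close>, an involution that preserves the real weight of
  \<open>v\<close>.\<close>

lemma clifford_selfadjoint: "cinner l2_space (clifford E v x) y = cinner l2_space x (clifford E v y)"
proof -
  have "cinner l2_space (clifford E v x) y =
      (\<Sum>\<^sub>\<infinity>p. cnj (clifford E v x (clifford_flip v p)) * y (clifford_flip v p))"
    unfolding cinner_l2 by (rule infsum_reindex_bij_betw[OF bij_clifford_flip, symmetric])
  then show ?thesis by (simp add: clifford_def cinner_l2 complex_cnj_scaleR)
qed

section \<open>Norm bound for signed sums of generators\<close>

lemma has_sum_finite_sum:
  fixes f :: "'i \<Rightarrow> 'a \<Rightarrow> 'b::topological_comm_monoid_add"
  assumes "finite I" "\<And>i. i \<in> I \<Longrightarrow> (f i has_sum s i) A"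
  shows "((\<lambda>x. \<Sum>i\<in>I. f i x) has_sum (\<Sum>i\<in>I. s i)) A"
  using assms by (induction I rule: finite_induct) (auto intro: has_sum_add)

definition clifford_sum :: "'v set set \<Rightarrow> 'v set \<Rightarrow> ('v \<Rightarrow> real) \<Rightarrow> ('v set \<times> nat \<Rightarrow> complex) \<Rightarrow>
    'v set \<times> nat \<Rightarrow> complex" where
  "clifford_sum E S \<epsilon> x p = (\<Sum>v\<in>S. \<epsilon> v *\<^sub>R clifford E v x p)"

lemma clifford_sum_closed:
  "\<lbrakk>finite S; x \<in> carrier l2_space\<rbrakk> \<Longrightarrow> clifford_sum E S \<epsilon> x \<in> carrier l2_space"
  using l2_sum_closed[of S "\<lambda>v p. \<epsilon> v *\<^sub>R clifford E v x p"]
  by (simp add: clifford_sum_def[abs_def] l2_scaleR_closed clifford_closed)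

text \<open>The real inner product on \<open>complex\<close> is the real part of the Hermitian one;
  it suffices for expanding squared norms.\<close>

lemma l2_summable_inner:
  assumes "x \<in> carrier l2_space" "y \<in> carrier l2_space"
  shows "(\<lambda>i. inner (x i) (y i)) summable_on UNIV"
proof -
  have "(\<lambda>i. inner (x i) (y i)) = (\<lambda>i. Re (cnj (x i) * y i))"
    by (simp add: inner_complex_def)
  then show ?thesis
    using summable_on_Re[OF l2_summable_cinner[OF assms]] by simp
qed

lemma clifford_anticommute:
  assumes "v \<noteq> w" and x: "x \<in> carrier l2_space"
  shows "(\<Sum>\<^sub>\<infinity>p. inner (clifford E v x p) (clifford E w x p)) =
    - (\<Sum>\<^sub>\<infinity>p. inner (clifford E w x p) (clifford E v x p))"
proof -
  \<comment> \<open>Reindexing by both flips exchanges the two arguments at which \<open>x\<close>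
    is evaluated; the weights then differ by the sign from
    \<open>clifford_weight_flip\<close>.\<close>
  let ?g = "\<lambda>p. clifford_flip v (clifford_flip w p)"
  have bij: "bij ?g"
    using bij_comp[OF bij_clifford_flip bij_clifford_flip, of v w] by (simp add: o_def)
  have *: "clifford_weight E v (clifford_flip w p) * clifford_weight E w (clifford_flip v p) =
      - (clifford_weight E v p * clifford_weight E w p)" for p
    using clifford_weight_flip[OF assms(1), of E p] by auto
  have flipped: "clifford E w x (?g p) = clifford_weight E w (clifford_flip v p) *\<^sub>R x (clifford_flip v p)" for p
    by (subst clifford_flip_commute) (simp add: clifford_def)
  have "inner (clifford E v x (?g p)) (clifford E w x (?g p)) =
      (clifford_weight E v (clifford_flip w p) * clifford_weight E w (clifford_flip v p)) *
        inner (x (clifford_flip w p)) (x (clifford_flip v p))" for p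
    unfolding flipped by (simp add: clifford_def)
  also have "\<dots> p = - inner (clifford E w x p) (clifford E v x p)" for p
    unfolding * by (simp add: clifford_def)
  finally have "(\<Sum>\<^sub>\<infinity>p. inner (clifford E v x (?g p)) (clifford E w x (?g p))) =
      (\<Sum>\<^sub>\<infinity>p. - inner (clifford E w x p) (clifford E v x p))" by simp
  then show ?thesis
    by (simp add: infsum_uminus
      infsum_reindex_bij_betw[OF bij, of "\<lambda>p. inner (clifford E v x p) (clifford E w x p)"])
qed

text \<open>Add the double sum to its transpose. This turns anticommutation into the cancellation of
  cross terms, both for operators and for finite matrices.\<close>

lemma sum_antisymmetric_offdiag:
  fixes d :: "'a \<Rightarrow> 'a \<Rightarrow> real"
  assumes "finite S" "\<And>v w. \<lbrakk>v \<in> S; w \<in> S; v \<noteq> w\<rbrakk> \<Longrightarrow> d v w = - d w v"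
  shows "(\<Sum>v\<in>S. \<Sum>w\<in>S. d v w) = (\<Sum>v\<in>S. d v v)"
proof -
  have "(\<Sum>v\<in>S. \<Sum>w\<in>S. d v w) = (\<Sum>v\<in>S. \<Sum>w\<in>S. d w v)" by (rule sum.swap)
  then have "2 * (\<Sum>v\<in>S. \<Sum>w\<in>S. d v w) = (\<Sum>v\<in>S. \<Sum>w\<in>S. d v w + d w v)"
    by (simp add: sum.distrib)
  also have "\<dots> = (\<Sum>v\<in>S. \<Sum>w\<in>S. if w = v then 2 * d v v else 0)"
  proof (intro sum.cong refl)
    show "d v w + d w v = (if w = v then 2 * d v v else 0)" if "v \<in> S" "w \<in> S" for v w
      by (cases "w = v") (simp, metis add.left_inverse assms(2) that)
  qed
  also have "\<dots> = 2 * (\<Sum>v\<in>S. d v v)"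
    using assms(1) by (simp add: sum_distrib_left)
  finally show ?thesis by simp
qed

text \<open>Anticommutation removes the cross terms, so the squared norm is the sum of the squared
  norms of the single terms. Pointwise, the squared weights of an edge add up to at most
  \<open>1\<close>.\<close>

lemma clifford_sum_contraction:
  assumes E: "\<And>e e'. \<lbrakk>e \<in> E; e' \<subseteq> e\<rbrakk> \<Longrightarrow> e' \<in> E" and S: "S \<in> E" "finite S"
    and \<epsilon>: "\<And>v. v \<in> S \<Longrightarrow> (\<epsilon> v)\<^sup>2 = 1" and x: "x \<in> carrier l2_space"
  shows "(\<Sum>\<^sub>\<infinity>p. (cmod (clifford_sum E S \<epsilon> x p))\<^sup>2) \<le> (\<Sum>\<^sub>\<infinity>p. (cmod (x p))\<^sup>2)"
proof -
  define d where "d v w = (\<Sum>\<^sub>\<infinity>p. inner (clifford E v x p) (clifford E w x p))" for v w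
  have d: "((\<lambda>p. inner (clifford E v x p) (clifford E w x p)) has_sum d v w) UNIV" for v w
    unfolding d_def by (intro has_sum_infsum l2_summable_inner clifford_closed x)
  have "((\<lambda>p. \<Sum>v\<in>S. \<Sum>w\<in>S. (\<epsilon> v * \<epsilon> w) * inner (clifford E v x p) (clifford E w x p))
      has_sum (\<Sum>v\<in>S. \<Sum>w\<in>S. (\<epsilon> v * \<epsilon> w) * d v w)) UNIV"
    by (intro has_sum_finite_sum has_sum_cmult_right d S(2))
  moreover have "(\<Sum>v\<in>S. \<Sum>w\<in>S. (\<epsilon> v * \<epsilon> w) * inner (clifford E v x p) (clifford E w x p)) =
      (cmod (clifford_sum E S \<epsilon> x p))\<^sup>2" for p
    by (simp add: power2_norm_eq_inner clifford_sum_def inner_sum_left inner_sum_right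
        sum_distrib_left mult_ac inner_commute)
  moreover have "(\<Sum>v\<in>S. \<Sum>w\<in>S. (\<epsilon> v * \<epsilon> w) * d v w) = (\<Sum>v\<in>S. (\<epsilon> v * \<epsilon> v) * d v v)"
  proof (rule sum_antisymmetric_offdiag[OF S(2)])
    fix v w assume "v \<in> S" "w \<in> S" "v \<noteq> w"
    have d_anti: "d v w = - d w v"
      unfolding d_def using \<open>v \<noteq> w\<close> x by (rule clifford_anticommute)
    show "(\<epsilon> v * \<epsilon> w) * d v w = - ((\<epsilon> w * \<epsilon> v) * d w v)" by (subst d_anti) simp
  qed
  moreover have "\<dots> = (\<Sum>v\<in>S. d v v)"
    using \<epsilon> by (intro sum.cong) (auto simp: power2_eq_square)
  ultimately have "(\<Sum>\<^sub>\<infinity>p. (cmod (clifford_sum E S \<epsilon> x p))\<^sup>2) = (\<Sum>v\<in>S. d v v)"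
    by (simp add: infsumI)
  moreover have "(\<Sum>v\<in>S. d v v) \<le> (\<Sum>\<^sub>\<infinity>p. (cmod (x p))\<^sup>2)"
  proof (rule has_sum_mono)
    \<comment> \<open>Reindexing by the flip of \<open>v\<close> moves the argument of
      \<open>x\<close> back to \<open>p\<close> and leaves the weight unchanged.\<close>
    have "((\<lambda>p. (clifford_weight E v p)\<^sup>2 * (cmod (x p))\<^sup>2) has_sum d v v) UNIV" for v
    proof -
      have "inner (clifford E v x (clifford_flip v p)) (clifford E v x (clifford_flip v p)) =
          (clifford_weight E v p)\<^sup>2 * (cmod (x p))\<^sup>2" for p
        by (simp add: clifford_def dot_square_norm power2_eq_square)
      then show ?thesis
        using d[of v v] has_sum_reindex_bij_betw[OF bij_clifford_flip, of
            "\<lambda>p. inner (clifford E v x p) (clifford E v x p)" v "d v v"]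
        by simp
    qed
    then show "((\<lambda>p. \<Sum>v\<in>S. (clifford_weight E v p)\<^sup>2 * (cmod (x p))\<^sup>2) has_sum (\<Sum>v\<in>S. d v v)) UNIV"
      by (intro has_sum_finite_sum S(2))
    show "((\<lambda>p. (cmod (x p))\<^sup>2) has_sum (\<Sum>\<^sub>\<infinity>p. (cmod (x p))\<^sup>2)) UNIV"
      using x by (intro has_sum_infsum) (simp add: l2_carrier)
    show "(\<Sum>v\<in>S. (clifford_weight E v p)\<^sup>2 * (cmod (x p))\<^sup>2) \<le> (cmod (x p))\<^sup>2" for p
    proof -
      have "(\<Sum>v\<in>S. (clifford_weight E v p)\<^sup>2) \<le> 1"
        using E S by (rule sum_clifford_weight_square_le)
      then show ?thesis
        using mult_right_mono[of _ 1 "(cmod (x p))\<^sup>2"] by (simp flip: sum_distrib_right)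
    qed
  qed
  ultimately show ?thesis by simp
qed

text \<open>Real combinations of self-adjoint operators have real expectation values; positivity
  below needs the imaginary part to vanish.\<close>

lemma cinner_clifford_sum_real:
  assumes S: "finite S" and x: "x \<in> carrier l2_space"
  shows "cinner l2_space x (clifford_sum E S \<epsilon> x) \<in> \<real>"
proof -
  interpret complex_inner_product_space l2_space by (rule complex_inner_product_space_l2)
  have "((\<lambda>p. \<Sum>v\<in>S. of_real (\<epsilon> v) * (cnj (x p) * clifford E v x p)) has_sum
      (\<Sum>v\<in>S. of_real (\<epsilon> v) * cinner l2_space x (clifford E v x))) UNIV"
    unfolding cinner_l2
    by (intro has_sum_finite_sum S has_sum_cmult_right has_sum_infsum l2_summable_cinner x clifford_closed)
  moreover have "(\<Sum>v\<in>S. of_real (\<epsilon> v) * (cnj (x p) * clifford E v x p)) =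
      cnj (x p) * clifford_sum E S \<epsilon> x p" for p
    by (simp add: clifford_sum_def sum_distrib_left scaleR_conv_of_real mult_ac)
  ultimately have "cinner l2_space x (clifford_sum E S \<epsilon> x) =
      (\<Sum>v\<in>S. of_real (\<epsilon> v) * cinner l2_space x (clifford E v x))"
    by (simp add: cinner_l2 infsumI)
  moreover have "cinner l2_space x (clifford E v x) \<in> \<real>" for v
    using cinner_commute[OF x clifford_closed[OF x], of E v]
    by (simp add: clifford_selfadjoint Reals_cnj_iff)
  ultimately show ?thesis by auto
qed

section \<open>The measurements and their joint observables\<close>

definition clifford_effect :: "'v set set \<Rightarrow> 'v set \<Rightarrow> ('v \<Rightarrow> real) \<Rightarrow> ('v set \<times> nat \<Rightarrow> complex) \<Rightarrow>
    'v set \<times> nat \<Rightarrow> complex" where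
  "clifford_effect E S \<epsilon> x p = (1 / 2 ^ card S) *\<^sub>R (x p + clifford_sum E S \<epsilon> x p)"

lemma clifford_effect_closed:
  "\<lbrakk>finite S; x \<in> carrier l2_space\<rbrakk> \<Longrightarrow> clifford_effect E S \<epsilon> x \<in> carrier l2_space"
  unfolding clifford_effect_def[abs_def]
  by (intro l2_scaleR_closed l2_add_closed clifford_sum_closed)

lemma clifford_sum_add:
  "clifford_sum E S \<epsilon> (\<lambda>i. x i + y i) p = clifford_sum E S \<epsilon> x p + clifford_sum E S \<epsilon> y p"
  by (simp add: clifford_sum_def clifford_def scaleR_add_right sum.distrib)

lemma clifford_sum_smult: "clifford_sum E S \<epsilon> (\<lambda>i. c * x i) p = c * clifford_sum E S \<epsilon> x p"
  by (simp add: clifford_sum_def clifford_def sum_distrib_left)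

lemma cnorm_add_le_double:
  assumes x: "x \<in> carrier l2_space" and y: "y \<in> carrier l2_space"
    and le: "cnorm l2_space y \<le> cnorm l2_space x"
  shows "cnorm l2_space (\<lambda>i. x i + y i) \<le> 2 * cnorm l2_space x"
proof -
  interpret complex_inner_product_space l2_space by (rule complex_inner_product_space_l2)
  show ?thesis using cnorm_triangle[OF x y] le by simp
qed

lemma cnorm_l2_scaleR:
  assumes "x \<in> carrier l2_space" and "0 \<le> r"
  shows "cnorm l2_space (\<lambda>i. (r::real) *\<^sub>R x i) = r * cnorm l2_space x"
proof -
  have "(\<Sum>\<^sub>\<infinity>i. (cmod (r *\<^sub>R x i))\<^sup>2) = r\<^sup>2 * (\<Sum>\<^sub>\<infinity>i. (cmod (x i))\<^sup>2)"
    by (simp add: power_mult_distrib infsum_cmult_right')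
  then show ?thesis
    using assms by (simp add: cnorm_l2 l2_scaleR_closed real_sqrt_mult)
qed

text \<open>For the contraction \<open>K = clifford_sum E S \<epsilon>\<close>, the squared norm of
  \<open>x + K x\<close> is nonnegative and at most twice the real part of
  \<open>cinner x x + cinner x (K x)\<close>. This gives positivity of \<open>I + K\<close> without
  spectral theory. The norm bound \<open>2\<close> is the triangle inequality.\<close>

lemma positive_operator_clifford_effect:
  assumes E: "\<And>e e'. \<lbrakk>e \<in> E; e' \<subseteq> e\<rbrakk> \<Longrightarrow> e' \<in> E" and S: "S \<in> E" "finite S"
    and \<epsilon>: "\<And>v. v \<in> S \<Longrightarrow> (\<epsilon> v)\<^sup>2 = 1"
  shows "positive_operator l2_space (clifford_effect E S \<epsilon>)"
  unfolding positive_operator_def bounded_operator_def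
proof (intro conjI ballI allI)
  let ?H = "l2_space :: ('a set \<times> nat \<Rightarrow> complex) inner_product_space"
  interpret complex_inner_product_space ?H by (rule complex_inner_product_space_l2)
  show "clifford_effect E S \<epsilon> \<in> carrier ?H \<rightarrow> carrier ?H"
    using clifford_effect_closed S(2) by blast
  have norm_le: "cnorm ?H (clifford_sum E S \<epsilon> x) \<le> cnorm ?H x" if x: "x \<in> carrier ?H" for x
    using clifford_sum_contraction[OF E S \<epsilon> x]
    by (simp add: cnorm_l2 clifford_sum_closed S(2) x)
  have "cnorm ?H (clifford_effect E S \<epsilon> x) \<le> 2 * cnorm ?H x" if x: "x \<in> carrier ?H" for x
  proof -
    have "cnorm ?H (clifford_effect E S \<epsilon> x) =
        (1 / 2 ^ card S) * cnorm ?H (\<lambda>p. x p + clifford_sum E S \<epsilon> x p)"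
      unfolding clifford_effect_def[abs_def]
      by (intro cnorm_l2_scaleR l2_add_closed clifford_sum_closed x S(2)) simp
    also have "\<dots> \<le> 1 * cnorm ?H (\<lambda>p. x p + clifford_sum E S \<epsilon> x p)"
      by (intro mult_right_mono)
        (auto simp: cnorm_l2 l2_add_closed clifford_sum_closed x S(2) infsum_nonneg)
    also have "\<dots> \<le> 2 * cnorm ?H x"
      using cnorm_add_le_double[OF x clifford_sum_closed[OF S(2) x] norm_le[OF x]] by simp
    finally show ?thesis .
  qed
  then show "\<exists>K. \<forall>x\<in>carrier ?H. cnorm ?H (clifford_effect E S \<epsilon> x) \<le> K * cnorm ?H x" by blast
  fix x assume x: "x \<in> carrier ?H"
  show "clifford_effect E S \<epsilon> (x \<oplus>\<^bsub>?H\<^esub> y) =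
      clifford_effect E S \<epsilon> x \<oplus>\<^bsub>?H\<^esub> clifford_effect E S \<epsilon> y" for y
    by (simp add: fun_eq_iff clifford_effect_def clifford_sum_add algebra_simps)
  show "clifford_effect E S \<epsilon> (c \<odot>\<^bsub>?H\<^esub> x) = c \<odot>\<^bsub>?H\<^esub> clifford_effect E S \<epsilon> x" for c
    by (simp add: fun_eq_iff clifford_effect_def clifford_sum_smult algebra_simps)
  let ?y = "clifford_sum E S \<epsilon> x"
  have y: "?y \<in> carrier ?H" by (rule clifford_sum_closed[OF S(2) x])
  have "0 \<le> Re (cinner ?H (\<lambda>p. x p + ?y p) (\<lambda>p. x p + ?y p))"
    using cinner_self[OF l2_add_closed[OF x y]] by blast
  also have "\<dots> = Re (cinner ?H x x) + 2 * Re (cinner ?H x ?y) + Re (cinner ?H ?y ?y)"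
    using cinner_line[OF x y, of 1] by simp
  also have "Re (cinner ?H ?y ?y) \<le> Re (cinner ?H x x)"
    using norm_le[OF x] by (simp add: cnorm_def)
  finally have "0 \<le> Re (cinner ?H x x) + Re (cinner ?H x ?y)" by simp
  moreover have "Im (cinner ?H x ?y) = 0"
    using cinner_clifford_sum_real[OF S(2) x] complex_is_Real_iff by blast
  moreover have "cinner ?H x (clifford_effect E S \<epsilon> x) =
      of_real (1 / 2 ^ card S) * (cinner ?H x x + cinner ?H x ?y)"
    using cinner_smult_right[OF x l2_add_closed[OF x y], of "of_real (1 / 2 ^ card S)"]
    by (simp add: clifford_effect_def[abs_def] scaleR_conv_of_real cinner_l2_add x y)
  ultimately show "cinner ?H x (clifford_effect E S \<epsilon> x) \<in> \<real>\<^sub>\<ge>\<^sub>0"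
    using cinner_self[OF x] by (simp add: complex_nonneg_Reals_iff)
qed

section \<open>Sign sums over outcome assignments, and marginals\<close>

definition outcome_sign :: "nat \<Rightarrow> real" where
  "outcome_sign j = (if j = 0 then 1 else -1)"

lemma outcome_sign_square [simp]: "(outcome_sign j)\<^sup>2 = 1"
  by (simp add: outcome_sign_def)

text \<open>Flipping the outcome at \<open>v\<close> permutes the index set, so the sum equals its
  own negative.\<close>

lemma sum_PiE_flip_eq_0:
  fixes g :: "('v \<Rightarrow> nat) \<Rightarrow> real"
  assumes v: "v \<in> S" and g: "\<And>f. f \<in> PiE S (\<lambda>_. {0,1}) \<Longrightarrow> g (f(v := 1 - f v)) = - g f"
  shows "(\<Sum>f\<in>PiE S (\<lambda>_. {0,1}). g f) = 0"
proof -
  have "(\<Sum>f\<in>PiE S (\<lambda>_. {0,1}). g f) = (\<Sum>f\<in>PiE S (\<lambda>_. {0,1}). g (f(v := 1 - f v)))"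
  proof (rule sum.reindex_bij_witness[of _ "\<lambda>f. f(v := 1 - f v)" "\<lambda>f. f(v := 1 - f v)"])
    fix f :: "'v \<Rightarrow> nat" assume f: "f \<in> PiE S (\<lambda>_. {0,1})"
    \<comment> \<open>Truncated subtraction \<open>1 - _\<close> is an involution only on
      \<open>{0,1}\<close>.\<close>
    then have "f v \<in> {0,1}" using v by blast
    then have inv: "(f(v := 1 - f v))(v := 1 - (f(v := 1 - f v)) v) = f" by auto
    show "(f(v := 1 - f v))(v := 1 - (f(v := 1 - f v)) v) = f" by (rule inv)
    then show "(f(v := 1 - f v))(v := 1 - (f(v := 1 - f v)) v) = f" .
    show "f(v := 1 - f v) \<in> PiE S (\<lambda>_. {0,1})" using f v by (auto simp: PiE_iff extensional_def)
    then show "f(v := 1 - f v) \<in> PiE S (\<lambda>_. {0,1})" .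
    show "g ((f(v := 1 - f v))(v := 1 - (f(v := 1 - f v)) v)) = g f" by (simp only: inv)
  qed
  also have "\<dots> = - (\<Sum>f\<in>PiE S (\<lambda>_. {0,1}). g f)"
    using g by (simp add: sum_negf)
  finally show ?thesis by simp
qed

lemma outcome_sign_flip: "j \<in> {0,1} \<Longrightarrow> outcome_sign (1 - j) = - outcome_sign j"
  by (auto simp: outcome_sign_def)

lemma sum_outcome_sign:
  assumes "v \<in> S"
  shows "(\<Sum>f\<in>PiE S (\<lambda>_. {0,1}). outcome_sign (f v)) = 0"
proof (rule sum_PiE_flip_eq_0[OF assms])
  fix f :: "'a \<Rightarrow> nat" assume "f \<in> PiE S (\<lambda>_. {0,1})"
  then have "f v \<in> {0,1}" using assms by blast
  from outcome_sign_flip[OF this]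
  show "outcome_sign ((f(v := 1 - f v)) v) = - outcome_sign (f v)" by simp
qed

text \<open>Orthogonality of sign characters: for \<open>v \<noteq> w\<close>, flipping only the
  outcome at \<open>v\<close> negates the product.\<close>

lemma sum_outcome_sign_mult:
  assumes "finite S" "v \<in> S" "w \<in> S"
  shows "(\<Sum>f\<in>PiE S (\<lambda>_. {0,1}). outcome_sign (f v) * outcome_sign (f w)) =
    (if v = w then 2 ^ card S else 0)"
proof (cases "v = w")
  case True
  then show ?thesis
    using assms by (simp add: power2_eq_square[symmetric] card_PiE)
next
  case False
  have "(\<Sum>f\<in>PiE S (\<lambda>_. {0,1}). outcome_sign (f v) * outcome_sign (f w)) = 0"
  proof (rule sum_PiE_flip_eq_0[OF assms(2)])
    fix f :: "'a \<Rightarrow> nat" assume "f \<in> PiE S (\<lambda>_. {0,1})"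
    then have "f v \<in> {0,1}" using assms(2) by blast
    from outcome_sign_flip[OF this] False
    show "outcome_sign ((f(v := 1 - f v)) v) * outcome_sign ((f(v := 1 - f v)) w) =
        - (outcome_sign (f v) * outcome_sign (f w))" by simp
  qed
  then show ?thesis using False by simp
qed

text \<open>The indicator of \<open>f i = j\<close> is
  \<open>(1 + outcome_sign j * outcome_sign (f i)) / 2\<close>. After expanding, orthogonality
  leaves only the identity and the generator of \<open>i\<close>, each with a factor
  \<open>2 ^ card S\<close> that cancels the normalisation down to \<open>1 / 2\<close>.\<close>

lemma clifford_effect_marginal:
  assumes S: "finite S" "i \<in> S" and j: "j \<in> {0,1}"
  shows "(\<Sum>f\<in>{f \<in> PiE S (\<lambda>_. {0,1}). f i = j}. clifford_effect E S (\<lambda>v. outcome_sign (f v)) x p) =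
    clifford_effect E {i} (\<lambda>_. outcome_sign j) x p"
proof -
  let ?P = "PiE S (\<lambda>_. {0,1::nat})" and ?s = "outcome_sign j"
  have fin: "finite ?P" using S by (intro finite_PiE) auto
  define c where "c f = 1 + ?s * outcome_sign (f i)" for f
  have ind: "c f / 2 = (if f i = j then 1 else 0)" if "f \<in> ?P" for f
    using PiE_mem[OF that S(2)] j by (auto simp: outcome_sign_def c_def)
  have "(\<Sum>f\<in>{f \<in> ?P. f i = j}. clifford_effect E S (\<lambda>v. outcome_sign (f v)) x p) =
      (\<Sum>f\<in>?P. (c f / 2) *\<^sub>R clifford_effect E S (\<lambda>v. outcome_sign (f v)) x p)"
    unfolding sum.inter_filter[OF fin] by (intro sum.cong refl) (simp add: ind)
  also have "\<dots> = (1 / 2 ^ card S / 2) *\<^sub>R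
      (\<Sum>f\<in>?P. c f *\<^sub>R (x p + clifford_sum E S (\<lambda>v. outcome_sign (f v)) x p))"
    by (simp add: clifford_effect_def scaleR_sum_right mult_ac)
  also have "(\<Sum>f\<in>?P. c f *\<^sub>R (x p + clifford_sum E S (\<lambda>v. outcome_sign (f v)) x p)) =
      (\<Sum>f\<in>?P. c f) *\<^sub>R x p + (\<Sum>v\<in>S. (\<Sum>f\<in>?P. c f * outcome_sign (f v)) *\<^sub>R clifford E v x p)"
    by (simp only: scaleR_add_right sum.distrib scaleR_sum_left clifford_sum_def scaleR_sum_right
        scaleR_scaleR sum.swap[of _ S])
  also have "(\<Sum>f\<in>?P. c f) = 2 ^ card S"
    using S by (simp add: c_def sum.distrib sum_distrib_left[symmetric] sum_outcome_sign card_PiE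
        del: One_nat_def)
  also have "(\<Sum>v\<in>S. (\<Sum>f\<in>?P. c f * outcome_sign (f v)) *\<^sub>R clifford E v x p) =
      (\<Sum>v\<in>S. if v = i then (?s * 2 ^ card S) *\<^sub>R clifford E v x p else 0)"
  proof (intro sum.cong refl)
    fix v assume v: "v \<in> S"
    have "(\<Sum>f\<in>?P. c f * outcome_sign (f v)) =
        (\<Sum>f\<in>?P. outcome_sign (f v)) + ?s * (\<Sum>f\<in>?P. outcome_sign (f i) * outcome_sign (f v))"
      by (simp add: c_def ring_distribs sum.distrib sum_distrib_left mult.assoc)
    also have "\<dots> = (if v = i then ?s * 2 ^ card S else 0)"
      using sum_outcome_sign[OF v] sum_outcome_sign_mult[OF S v] by simp
    finally show "(\<Sum>f\<in>?P. c f * outcome_sign (f v)) *\<^sub>R clifford E v x p =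
        (if v = i then (?s * 2 ^ card S) *\<^sub>R clifford E v x p else 0)" by simp
  qed
  also have "\<dots> = (?s * 2 ^ card S) *\<^sub>R clifford E i x p" using S by simp
  finally show ?thesis
    by (simp add: clifford_effect_def clifford_sum_def algebra_simps)
qed

text \<open>Each sign sums to \<open>0\<close>, so the generators cancel and
  \<open>2 ^ card S\<close> copies of the identity remain.\<close>

lemma clifford_effect_total:
  assumes S: "finite S"
  shows "(\<Sum>f\<in>PiE S (\<lambda>_. {0,1}). clifford_effect E S (\<lambda>v. outcome_sign (f v)) x p) = x p"
proof -
  let ?P = "PiE S (\<lambda>_. {0,1::nat})"
  have "(\<Sum>f\<in>?P. clifford_effect E S (\<lambda>v. outcome_sign (f v)) x p) =
      (1 / 2 ^ card S) *\<^sub>R (real (card ?P) *\<^sub>R x p +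
        (\<Sum>v\<in>S. (\<Sum>f\<in>?P. outcome_sign (f v)) *\<^sub>R clifford E v x p))"
    unfolding clifford_effect_def clifford_sum_def scaleR_sum_right[symmetric] sum.distrib
      scaleR_sum_left sum.swap[of _ S] by (simp add: scaleR_conv_of_real)
  then show ?thesis using S by (simp add: sum_outcome_sign card_PiE del: One_nat_def)
qed

text \<open>The one-vertex case of the joint observable, so positivity specialises to it and the
  marginals have this form.\<close>

definition clifford_povm :: "'v set set \<Rightarrow> 'v \<Rightarrow> nat \<Rightarrow> ('v set \<times> nat \<Rightarrow> complex) \<Rightarrow>
    'v set \<times> nat \<Rightarrow> complex" where
  "clifford_povm E v j = clifford_effect E {v} (\<lambda>_. outcome_sign j)"

lemma povm_clifford_povm:
  assumes E: "\<And>e e'. \<lbrakk>e \<in> E; e' \<subseteq> e\<rbrakk> \<Longrightarrow> e' \<in> E" and v: "{v} \<in> E"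
  shows "povm l2_space {0,1} (clifford_povm E v)"
  unfolding povm_def
proof
  show "\<forall>j\<in>{0,1}. positive_operator l2_space (clifford_povm E v j)"
    unfolding clifford_povm_def using v
    by (intro ballI positive_operator_clifford_effect[OF E]) auto
  show "has_strong_sum l2_space (clifford_povm E v) {0,1} (\<lambda>x. x)"
    by (subst has_strong_sum_l2_finite)
      (auto simp: clifford_povm_def clifford_effect_closed clifford_effect_def clifford_sum_def
        outcome_sign_def fun_eq_iff algebra_simps simp flip: scaleR_add_left)
qed

lemma jointly_measurable_clifford_povm:
  assumes E: "\<And>e e'. \<lbrakk>e \<in> E; e' \<subseteq> e\<rbrakk> \<Longrightarrow> e' \<in> E" and S: "S \<in> E" "finite S"
  shows "jointly_measurable l2_space S (\<lambda>_. {0,1}) (clifford_povm E)"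
  unfolding jointly_measurable_def
proof (intro exI[of _ "\<lambda>f. clifford_effect E S (\<lambda>v. outcome_sign (f v))"] conjI ballI)
  let ?G = "\<lambda>f. clifford_effect E S (\<lambda>v. outcome_sign (f v))"
  have fin: "finite (PiE S (\<lambda>_. {0,1::nat}))" using S by (intro finite_PiE) auto
  show "povm l2_space (PiE S (\<lambda>_. {0,1})) ?G"
    unfolding povm_def
  proof
    show "\<forall>f\<in>PiE S (\<lambda>_. {0,1}). positive_operator l2_space (?G f)"
      by (intro ballI positive_operator_clifford_effect[OF E S]) auto
    show "has_strong_sum l2_space ?G (PiE S (\<lambda>_. {0,1})) (\<lambda>x. x)"
      using S fin by (subst has_strong_sum_l2_finite)
        (auto simp: clifford_effect_closed clifford_effect_total fun_eq_iff simp del: One_nat_def)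
  qed
  fix i and j :: nat assume "i \<in> S" "j \<in> {0,1}"
  then show "has_strong_sum l2_space ?G {f \<in> PiE S (\<lambda>_. {0,1}). f i = j} (clifford_povm E i j)"
    using S fin by (subst has_strong_sum_l2_finite)
      (auto simp: clifford_effect_closed clifford_effect_marginal clifford_povm_def fun_eq_iff
        simp del: One_nat_def)
qed

section \<open>Incompatibility of a non-edge\<close>

text \<open>By \<open>sq\<close>, the matrix \<open>D\<close> times its transpose is
  \<open>r\<close> times \<open>D\<close>. Hence \<open>r\<close> times the pairing of
  \<open>D\<close> with \<open>h\<close> is a sum of quadratic forms of \<open>h\<close>, one at
  each column of \<open>D\<close>.\<close>

lemma psd_frobenius_nonneg:
  fixes h D :: "'a \<Rightarrow> 'a \<Rightarrow> real"
  assumes psd: "\<And>c. 0 \<le> (\<Sum>a\<in>K. \<Sum>b\<in>K. c a * c b * h a b)"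
    and sq: "\<And>a b. \<lbrakk>a \<in> K; b \<in> K\<rbrakk> \<Longrightarrow> (\<Sum>k\<in>K. D a k * D b k) = r * D a b" and "r > 0"
  shows "0 \<le> (\<Sum>a\<in>K. \<Sum>b\<in>K. D a b * h a b)"
proof -
  have "0 \<le> (\<Sum>k\<in>K. \<Sum>a\<in>K. \<Sum>b\<in>K. D a k * D b k * h a b)"
    by (intro sum_nonneg psd)
  also have "\<dots> = (\<Sum>a\<in>K. \<Sum>b\<in>K. \<Sum>k\<in>K. D a k * D b k * h a b)"
    by (subst sum.swap) (intro sum.cong refl sum.swap)
  also have "\<dots> = (\<Sum>a\<in>K. \<Sum>b\<in>K. r * (D a b * h a b))"
    by (intro sum.cong refl) (simp add: sum_distrib_right[symmetric] sq)
  also have "\<dots> = r * (\<Sum>a\<in>K. \<Sum>b\<in>K. D a b * h a b)" by (simp add: sum_distrib_left)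
  finally show ?thesis using \<open>r > 0\<close> by (simp add: zero_le_mult_iff)
qed

text \<open>Anticommutation in matrix form: the products are the nonzero entries in row
  \<open>a\<close> of the two composites of generators \<open>i\<close> and
  \<open>j\<close>.\<close>

lemma jw_sign_flip_antisym:
  assumes "i \<noteq> j"
  shows "jw_sign i a * jw_sign j (flip_bit i a) = - (jw_sign j a * jw_sign i (flip_bit j a))"
  using assms by (auto simp: jw_sign_flip_bit)

text \<open>With \<open>C = (\<Sum>v\<in>S. \<epsilon> v C\<^sub>v)\<close> a signed sum of \<open>n\<close> anticommuting reflections, \<open>C\<^sup>2 = n\<close>, so that
  \<open>D = \<surd>n - C\<close> satisfies \<open>D\<^sup>2 = 2 \<surd>n D\<close>.\<close>

lemma jw_trace_bound:
  fixes h :: "nat \<Rightarrow> nat \<Rightarrow> real"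
  assumes psd: "\<And>c. 0 \<le> (\<Sum>a<2 ^ m. \<Sum>b<2 ^ m. c a * c b * h a b)"
    and S: "finite S" "S \<noteq> {}" and t: "inj_on t S" "\<And>v. v \<in> S \<Longrightarrow> t v < m"
    and \<epsilon>: "\<And>v. v \<in> S \<Longrightarrow> (\<epsilon> v)\<^sup>2 = (1::real)"
  shows "(\<Sum>v\<in>S. \<epsilon> v * (\<Sum>a<2 ^ m. jw_sign (t v) a * h a (flip_bit (t v) a))) \<le>
    sqrt (card S) * (\<Sum>a<2 ^ m. h a a)"
proof -
  let ?K = "{..<2 ^ m :: nat}" and ?r = "sqrt (card S)"
  \<comment> \<open>The matrix of the signed sum without \<eta>: in row \<open>a\<close>, the
    generator of \<open>v\<close> has its only nonzero entry in column
    \<open>flip_bit (t v) a\<close>.\<close>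
  define C where "C a b = (\<Sum>v\<in>S. \<epsilon> v * jw_sign (t v) a * (if b = flip_bit (t v) a then 1 else 0))" for a b
  define D where "D a b = ?r * (if b = a then 1 else 0) - C a b" for a b
  have flip_iff: "b = flip_bit i a \<longleftrightarrow> a = flip_bit i b" for a b i :: nat by auto
  have C_sym: "C b a = C a b" for a b
    unfolding C_def
    by (intro sum.cong refl) (auto simp: flip_iff[of a] jw_sign_flip_bit)
  have C_sq: "(\<Sum>k\<in>?K. C a k * C b k) = (if b = a then real (card S) else 0)"
    if ab: "a \<in> ?K" "b \<in> ?K" for a b
  proof -
    \<comment> \<open>The contribution of the pair \<open>v\<close>, \<open>w\<close> to entry
      \<open>(a, b)\<close> of \<open>C\<close> times its transpose. Both rows must be nonzero in
      the same column \<open>k\<close>, so the sum over \<open>k\<close> has at most one nonzero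
      term.\<close>
    define d where "d v w = \<epsilon> v * jw_sign (t v) a * (\<epsilon> w * jw_sign (t w) b) *
        (if flip_bit (t v) a = flip_bit (t w) b then 1 else 0)" for v w
    have "(\<Sum>k\<in>?K. C a k * C b k) = (\<Sum>k\<in>?K. \<Sum>v\<in>S. \<Sum>w\<in>S.
        \<epsilon> v * jw_sign (t v) a * (if k = flip_bit (t v) a then 1 else 0) *
        (\<epsilon> w * jw_sign (t w) b * (if k = flip_bit (t w) b then 1 else 0)))"
      unfolding C_def sum_product ..
    also have "\<dots> = (\<Sum>v\<in>S. \<Sum>w\<in>S. \<Sum>k\<in>?K.
        \<epsilon> v * jw_sign (t v) a * (if k = flip_bit (t v) a then 1 else 0) *
        (\<epsilon> w * jw_sign (t w) b * (if k = flip_bit (t w) b then 1 else 0)))"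
      by (subst sum.swap) (intro sum.cong refl sum.swap)
    also have "\<dots> = (\<Sum>v\<in>S. \<Sum>w\<in>S. d v w)"
    proof (intro sum.cong refl)
      fix v w assume "v \<in> S" "w \<in> S"
      have "(\<Sum>k\<in>?K. \<epsilon> v * jw_sign (t v) a * (if k = flip_bit (t v) a then 1 else 0) *
          (\<epsilon> w * jw_sign (t w) b * (if k = flip_bit (t w) b then 1 else 0))) =
          (\<Sum>k\<in>?K. if k = flip_bit (t v) a then d v w else 0)"
        by (intro sum.cong refl) (auto simp: d_def)
      also have "\<dots> = d v w"
        using flip_bit_less_power[OF t(2)[OF \<open>v \<in> S\<close>], of a] ab by simp
      finally show "(\<Sum>k\<in>?K. \<epsilon> v * jw_sign (t v) a * (if k = flip_bit (t v) a then 1 else 0) *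
          (\<epsilon> w * jw_sign (t w) b * (if k = flip_bit (t w) b then 1 else 0))) = d v w" .
    qed
    also have "\<dots> = (\<Sum>v\<in>S. d v v)"
    proof (rule sum_antisymmetric_offdiag[OF S(1)])
      fix v w assume vw: "v \<in> S" "w \<in> S" "v \<noteq> w"
      then have ne: "t v \<noteq> t w" using t(1) by (auto dest: inj_onD)
      \<comment> \<open>Both sides say that \<open>b\<close> arises from \<open>a\<close> by the two
        flips, in either order, so \<open>d v w\<close> and \<open>d w v\<close> vanish
        together.\<close>
      have swap: "flip_bit (t v) a = flip_bit (t w) b \<longleftrightarrow> flip_bit (t w) a = flip_bit (t v) b"
        by (metis flip_bit_flip_bit flip_bit_commute)
      show "d v w = - d w v"
      proof (cases "flip_bit (t v) a = flip_bit (t w) b")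
        case True
        then have "jw_sign (t w) (flip_bit (t v) a) = jw_sign (t w) b"
          and "jw_sign (t v) (flip_bit (t w) a) = jw_sign (t v) b"
          using swap by (simp_all add: jw_sign_flip_bit)
        then have "jw_sign (t v) a * jw_sign (t w) b = - (jw_sign (t w) a * jw_sign (t v) b)"
          using jw_sign_flip_antisym[OF ne, of a] by simp
        moreover have "d v w = \<epsilon> v * \<epsilon> w * (jw_sign (t v) a * jw_sign (t w) b)"
          and "d w v = \<epsilon> v * \<epsilon> w * (jw_sign (t w) a * jw_sign (t v) b)"
          using True swap by (simp_all add: d_def)
        ultimately show ?thesis by simp
      qed (use swap in \<open>simp add: d_def\<close>)
    qed
    also have "\<dots> = (\<Sum>v\<in>S. if b = a then 1 else 0)"
    proof (intro sum.cong refl)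
      fix v assume "v \<in> S"
      have "flip_bit (t v) a = flip_bit (t v) b \<longleftrightarrow> b = a" by (metis flip_bit_flip_bit)
      then show "d v v = (if b = a then 1 else 0)"
        using \<epsilon>[OF \<open>v \<in> S\<close>] jw_sign_mult_self[of "t v" a]
        by (auto simp: d_def power2_eq_square algebra_simps simp del: jw_sign_mult_self)
    qed
    finally show ?thesis by simp
  qed
  have "0 \<le> (\<Sum>a\<in>?K. \<Sum>b\<in>?K. D a b * h a b)"
  proof (rule psd_frobenius_nonneg[OF psd])
    show "0 < 2 * ?r" using S by (simp add: card_gt_0_iff)
    fix a b assume ab: "a \<in> ?K" "b \<in> ?K"
    have "(\<Sum>k\<in>?K. D a k * D b k) = (\<Sum>k\<in>?K. (if k = a then ?r * ?r * (if a = b then 1 else 0) else 0)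
        - (if k = a then ?r * C b a else 0) - (if k = b then ?r * C a b else 0) + C a k * C b k)"
      by (intro sum.cong refl) (auto simp: D_def algebra_simps)
    also have "\<dots> = ?r * ?r * (if a = b then 1 else 0) - ?r * C b a - ?r * C a b +
        (if b = a then real (card S) else 0)"
      using ab by (simp add: sum.distrib sum_subtractf C_sq)
    \<comment> \<open>The diagonal receives \<open>card S\<close> twice, since
      \<open>?r * ?r\<close> equals \<open>card S\<close>; symmetry of \<open>C\<close> merges the
      cross terms.\<close>
    also have "\<dots> = 2 * ?r * D a b" by (simp add: D_def C_sym[of b a] algebra_simps)
    finally show "(\<Sum>k\<in>?K. D a k * D b k) = 2 * ?r * D a b" .
  qed
  also have "(\<Sum>a\<in>?K. \<Sum>b\<in>?K. D a b * h a b) =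
      (\<Sum>a\<in>?K. \<Sum>b\<in>?K. (if b = a then ?r * h a a else 0)) - (\<Sum>a\<in>?K. \<Sum>b\<in>?K. C a b * h a b)"
    unfolding sum_subtractf[symmetric] by (intro sum.cong refl) (auto simp: D_def algebra_simps)
  also have "(\<Sum>a\<in>?K. \<Sum>b\<in>?K. (if b = a then ?r * h a a else 0)) = ?r * (\<Sum>a\<in>?K. h a a)"
    by (simp add: sum_distrib_left)
  also have "(\<Sum>a\<in>?K. \<Sum>b\<in>?K. C a b * h a b) =
      (\<Sum>a\<in>?K. \<Sum>v\<in>S. \<epsilon> v * (jw_sign (t v) a * h a (flip_bit (t v) a)))"
  proof (intro sum.cong refl)
    fix a assume a: "a \<in> ?K"
    have "(\<Sum>b\<in>?K. C a b * h a b) = (\<Sum>v\<in>S. \<Sum>b\<in>?K.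
        if b = flip_bit (t v) a then \<epsilon> v * (jw_sign (t v) a * h a b) else 0)"
      unfolding C_def sum_distrib_right by (subst sum.swap) (intro sum.cong refl, auto)
    also have "\<dots> = (\<Sum>v\<in>S. \<epsilon> v * (jw_sign (t v) a * h a (flip_bit (t v) a)))"
      using a t(2) by (intro sum.cong refl) (simp add: flip_bit_less_power)
    finally show "(\<Sum>b\<in>?K. C a b * h a b) =
      (\<Sum>v\<in>S. \<epsilon> v * (jw_sign (t v) a * h a (flip_bit (t v) a)))" .
  qed
  also have "\<dots> = (\<Sum>v\<in>S. \<epsilon> v * (\<Sum>a\<in>?K. jw_sign (t v) a * h a (flip_bit (t v) a)))"
    by (subst sum.swap) (simp add: sum_distrib_left)
  finally show ?thesis by simp
qed

section \<open>Matrix entries of operators in the standard basis\<close>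

definition basis_vector :: "'i \<Rightarrow> 'i \<Rightarrow> complex" where
  "basis_vector p q = (if q = p then 1 else 0)"

lemma basis_vector_closed: "basis_vector p \<in> carrier l2_space"
proof -
  have "((\<lambda>q. (cmod (basis_vector p q))\<^sup>2) has_sum 1) UNIV"
    by (rule has_sum_finite_neutralI[of "{p}"]) (auto simp: basis_vector_def)
  then show ?thesis by (auto simp: l2_carrier summable_on_def)
qed

lemma bounded_operator_l2_sum:
  assumes A: "bounded_operator l2_space A" and K: "finite K"
    and x: "\<And>b. b \<in> K \<Longrightarrow> x b \<in> carrier l2_space"
  shows "A (\<lambda>p. \<Sum>b\<in>K. c b * x b p) = (\<lambda>p. \<Sum>b\<in>K. c b * A (x b) p)"
proof -
  have add: "A (\<lambda>i. y i + z i) = (\<lambda>i. A y i + A z i)"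
    if "y \<in> carrier l2_space" "z \<in> carrier l2_space" for y z
  proof -
    have "A (y \<oplus>\<^bsub>l2_space\<^esub> z) = A y \<oplus>\<^bsub>l2_space\<^esub> A z"
      using A that unfolding bounded_operator_def by blast
    then show ?thesis by simp
  qed
  have smult: "A (\<lambda>i. r * y i) = (\<lambda>i. r * A y i)" if "y \<in> carrier l2_space" for r y
  proof -
    have "A (r \<odot>\<^bsub>l2_space\<^esub> y) = r \<odot>\<^bsub>l2_space\<^esub> A y"
      using A that unfolding bounded_operator_def by blast
    then show ?thesis by simp
  qed
  show ?thesis
    using K x
  proof (induction K rule: finite_induct)
    case empty
    then show ?case using smult[OF l2_zero_closed, of 0] by simp
  next
    case (insert b K)
    have "A (\<lambda>p. c b * x b p + (\<Sum>b\<in>K. c b * x b p)) =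
        (\<lambda>p. A (\<lambda>p. c b * x b p) p + A (\<lambda>p. \<Sum>b\<in>K. c b * x b p) p)"
      using insert by (intro add l2_sum_closed l2_smult_closed) auto
    then show ?case using insert by (simp add: smult)
  qed
qed

text \<open>Evaluate positivity at the vector with coordinates \<open>c\<close> on the chosen basis
  vectors. Real coefficients suffice because the trace bound concerns real matrices, so only real
  parts of entries are kept.\<close>

lemma positive_operator_l2_psd:
  assumes A: "positive_operator l2_space A" and K: "finite K" and g: "inj_on g K"
  shows "0 \<le> (\<Sum>a\<in>K. \<Sum>b\<in>K. c a * c b * Re (A (basis_vector (g b)) (g a)))"
proof -
  define y where "y = (\<lambda>p. \<Sum>b\<in>K. of_real (c b) * basis_vector (g b) p)"
  have y: "y \<in> carrier l2_space"
    unfolding y_def using K by (intro l2_sum_closed l2_smult_closed basis_vector_closed)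
  have yg: "y (g a) = of_real (c a)" if "a \<in> K" for a
  proof -
    have "y (g a) = (\<Sum>b\<in>K. if b = a then of_real (c b) else 0)"
      unfolding y_def using g that by (intro sum.cong) (auto simp: basis_vector_def dest: inj_onD)
    then show ?thesis using K that by simp
  qed
  have "((\<lambda>p. cnj (y p) * A y p) has_sum (\<Sum>p\<in>g ` K. cnj (y p) * A y p)) UNIV"
  proof (rule has_sum_finite_neutralI[of "g ` K"])
    show "cnj (y p) * A y p = 0" if "p \<in> UNIV - g ` K" for p
      using that by (auto simp: y_def basis_vector_def intro!: sum.neutral)
  qed (use K in auto)
  then have "cinner l2_space y (A y) = (\<Sum>a\<in>K. of_real (c a) * A y (g a))"
    using g by (simp add: cinner_l2 infsumI sum.reindex yg)
  moreover have "A y = (\<lambda>p. \<Sum>b\<in>K. of_real (c b) * A (basis_vector (g b)) p)"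
    unfolding y_def using A K
    by (intro bounded_operator_l2_sum) (auto simp: positive_operator_def basis_vector_closed)
  then have "A y (g a) = (\<Sum>b\<in>K. of_real (c b) * A (basis_vector (g b)) (g a))" for a
    by (rule fun_cong)
  ultimately have "Re (cinner l2_space y (A y)) =
      (\<Sum>a\<in>K. \<Sum>b\<in>K. c a * c b * Re (A (basis_vector (g b)) (g a)))"
    by (simp add: sum_distrib_left mult.assoc)
  then show ?thesis
    using A y by (auto simp: positive_operator_def complex_nonneg_Reals_iff)
qed

text \<open>Only the block labelled by \<open>S\<close> itself is examined, on its labels below
  \<open>2 ^ card S\<close>. Each \<open>G f\<close> is tested against the signed sum given by its
  own outcomes.\<close>

lemma not_jointly_measurable_clifford_povm:
  assumes S: "finite S" "S \<notin> E" "card S \<ge> 2"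
  shows "\<not> jointly_measurable l2_space S (\<lambda>_. {0,1}) (clifford_povm E)"
proof
  let ?n = "card S" and ?P = "PiE S (\<lambda>_. {0,1::nat})" and ?e = "\<lambda>b. basis_vector (S, b::nat)"
  let ?t = "to_nat_on S" and ?\<eta> = "block_scale E S"
  let ?s = "\<lambda>v. jw_sign (?t v)" and ?F = "\<lambda>v. flip_bit (?t v)"
  assume "jointly_measurable l2_space S (\<lambda>_. {0,1}) (clifford_povm E)"
  then obtain G where povm: "povm l2_space ?P G"
    and marg: "\<And>v j. \<lbrakk>v \<in> S; j \<in> {0,1}\<rbrakk> \<Longrightarrow>
      has_strong_sum l2_space G {f \<in> ?P. f v = j} (clifford_povm E v j)"
    unfolding jointly_measurable_def by blast
  have fin: "finite ?P" using S by (intro finite_PiE) auto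
  have pos: "positive_operator l2_space (G f)" if "f \<in> ?P" for f
    using povm that by (simp add: povm_def)
  have G_closed: "G f x \<in> carrier l2_space" if "f \<in> ?P" "x \<in> carrier l2_space" for f x
    using pos[OF that(1)] that(2) by (auto simp: positive_operator_def bounded_operator_def)
  define h where "h f a b = Re (G f (?e b) (S, a))" for f a b
  have total: "(\<Sum>f\<in>?P. h f a a) = 1" for a
  proof -
    have "has_strong_sum l2_space G ?P (\<lambda>x. x)" using povm by (simp add: povm_def)
    then have "\<forall>x\<in>carrier l2_space. x = (\<lambda>p. \<Sum>f\<in>?P. G f x p)"
      using has_strong_sum_l2_finite[of ?P G "\<lambda>x. x", OF fin] G_closed by blast
    from bspec[OF this basis_vector_closed]
    have "?e a = (\<lambda>p. \<Sum>f\<in>?P. G f (?e a) p)" .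
    then have "?e a (S, a) = (\<Sum>f\<in>?P. G f (?e a) (S, a))" by metis
    then have "(\<Sum>f\<in>?P. G f (?e a) (S, a)) = 1" by (simp add: basis_vector_def)
    then show ?thesis unfolding h_def by (metis Re_sum one_complex.sel(1))
  qed
  \<comment> \<open>Weighting outcomes by sign takes the difference of the two marginals of
    \<open>v\<close>, which is the scaled generator. Column \<open>?F v a\<close> holds its nonzero
    entry in row \<open>a\<close>.\<close>
  have signed: "(\<Sum>f\<in>?P. outcome_sign (f v) * h f a (?F v a)) = ?\<eta> * ?s v a" if v: "v \<in> S" for v a
  proof -
    let ?b = "?F v a"
    have m: "(\<Sum>f\<in>{f \<in> ?P. f v = j}. h f a ?b) = Re (clifford_povm E v j (?e ?b) (S, a))"
      if "j \<in> {0,1}" for j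
    proof -
      let ?Q = "{f \<in> ?P. f v = j}"
      have "finite ?Q" using fin by simp
      then have "\<forall>x\<in>carrier l2_space. clifford_povm E v j x = (\<lambda>p. \<Sum>f\<in>?Q. G f x p)"
        using marg[OF v that] has_strong_sum_l2_finite[of ?Q G "clifford_povm E v j"] G_closed by blast
      from bspec[OF this basis_vector_closed]
      have "clifford_povm E v j (?e ?b) = (\<lambda>p. \<Sum>f\<in>?Q. G f (?e ?b) p)" .
      then show ?thesis by (simp add: h_def)
    qed
    have "(\<Sum>f\<in>?P. outcome_sign (f v) * h f a ?b) =
        (\<Sum>f\<in>?P. (if f v = 0 then h f a ?b else 0) - (if f v = 1 then h f a ?b else 0))"
    proof (intro sum.cong refl)
      fix f assume "f \<in> ?P"
      then have "f v \<in> {0,1}" using v by blast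
      then show "outcome_sign (f v) * h f a ?b =
          (if f v = 0 then h f a ?b else 0) - (if f v = 1 then h f a ?b else 0)"
        by (auto simp: outcome_sign_def)
    qed
    also have "\<dots> = (\<Sum>f\<in>{f \<in> ?P. f v = 0}. h f a ?b) - (\<Sum>f\<in>{f \<in> ?P. f v = 1}. h f a ?b)"
      by (simp only: sum_subtractf sum.inter_filter[OF fin])
    also have "\<dots> = Re (clifford E v (?e ?b) (S, a))"
      using m[of 0] m[of 1]
      by (simp add: clifford_povm_def clifford_effect_def clifford_sum_def outcome_sign_def
          algebra_simps)
    also have "\<dots> = ?\<eta> * ?s v a"
      using v by (simp add: clifford_def clifford_flip_def clifford_weight_def basis_vector_def)
    finally show ?thesis .
  qed
  have bij: "bij_betw ?t S {..<?n}" using S(1) by (rule to_nat_on_finite)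
  have bound: "(\<Sum>v\<in>S. outcome_sign (f v) * (\<Sum>a<2 ^ ?n. ?s v a * h f a (?F v a))) \<le>
      sqrt ?n * (\<Sum>a<2 ^ ?n. h f a a)" if f: "f \<in> ?P" for f
  proof (rule jw_trace_bound)
    show "0 \<le> (\<Sum>a<2 ^ ?n. \<Sum>b<2 ^ ?n. c a * c b * h f a b)" for c
      unfolding h_def by (rule positive_operator_l2_psd[OF pos[OF f]]) (auto simp: inj_on_def)
  qed (use S bij in \<open>auto simp: bij_betw_def\<close>)
  have "(\<Sum>f\<in>?P. \<Sum>v\<in>S. outcome_sign (f v) * (\<Sum>a<2 ^ ?n. ?s v a * h f a (?F v a))) =
      (\<Sum>v\<in>S. \<Sum>f\<in>?P. \<Sum>a<2 ^ ?n. ?s v a * (outcome_sign (f v) * h f a (?F v a)))"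
    by (subst sum.swap) (simp add: sum_distrib_left mult_ac)
  also have "\<dots> = (\<Sum>v\<in>S. \<Sum>a<2 ^ ?n. ?s v a * (\<Sum>f\<in>?P. outcome_sign (f v) * h f a (?F v a)))"
    unfolding sum_distrib_left by (intro sum.cong refl sum.swap)
  \<comment> \<open>The sign squares to \<open>1\<close>, so each vertex contributes
    \<open>?\<eta>\<close> at each of the \<open>2 ^ ?n\<close> labels.\<close>
  also have "\<dots> = (\<Sum>v\<in>S. \<Sum>a<2 ^ ?n :: nat. ?\<eta>)"
    by (intro sum.cong refl) (simp add: signed mult.left_commute[of _ ?\<eta>] del: One_nat_def)
  also have "\<dots> = ?n * 2 ^ ?n * ?\<eta>" by simp
  finally have "?n * 2 ^ ?n * ?\<eta> =
      (\<Sum>f\<in>?P. \<Sum>v\<in>S. outcome_sign (f v) * (\<Sum>a<2 ^ ?n. ?s v a * h f a (?F v a)))" ..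
  also have "\<dots> \<le> (\<Sum>f\<in>?P. sqrt ?n * (\<Sum>a<2 ^ ?n. h f a a))"
    by (rule sum_mono[OF bound])
  also have "\<dots> = sqrt ?n * (\<Sum>a<2 ^ ?n. \<Sum>f\<in>?P. h f a a)"
    unfolding sum_distrib_left[symmetric] by (subst sum.swap) (rule refl)
  also have "\<dots> = sqrt ?n * 2 ^ ?n" by (simp add: total del: One_nat_def)
  finally have "?n * ?\<eta> \<le> sqrt ?n" by simp
  moreover have "?\<eta> = 1 / sqrt (real ?n - 1)"
    using S by (simp add: block_scale_def of_nat_diff)
  \<comment> \<open>\<open>card S \<ge> 2\<close> makes \<open>sqrt (real ?n - 1)\<close> positive,
    so the denominator can be cleared.\<close>
  ultimately have "sqrt ?n * sqrt ?n \<le> sqrt ?n * sqrt (real ?n - 1)"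
    using S(3) by (simp add: divide_simps)
  then have "sqrt ?n \<le> sqrt (real ?n - 1)"
    by (rule mult_left_le_imp_le) (use S(3) in simp)
  then show False by simp
qed

theorem mainTheorem1:
  fixes V :: "'v set" and E :: "'v set set"
  assumes "joint_measurability_hypergraph V E"
  shows "\<exists>(H :: ('v set \<times> nat \<Rightarrow> complex) inner_product_space)
            (\<Omega> :: 'v \<Rightarrow> nat set) M. quantum_realization V E H \<Omega> M"
proof (intro exI)
  have E: "e' \<in> E" if "e \<in> E" "e' \<subseteq> e" for e e'
    using assms that unfolding joint_measurability_hypergraph_def by blast
  have single: "{v} \<in> E" if "v \<in> V" for v
    using assms that unfolding joint_measurability_hypergraph_def by blast
  show "quantum_realization V E l2_space (\<lambda>_. {0,1}) (clifford_povm E)"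
    unfolding quantum_realization_def
  proof (intro conjI allI impI ballI)
    show "povm l2_space {0,1} (clifford_povm E v)" if "v \<in> V" for v
      using E single[OF that] by (rule povm_clifford_povm)
    fix S assume S: "finite S \<and> S \<noteq> {} \<and> S \<subseteq> V"
    show "jointly_measurable l2_space S (\<lambda>_. {0,1}) (clifford_povm E) \<longleftrightarrow> S \<in> E"
    proof
      assume "S \<in> E"
      then show "jointly_measurable l2_space S (\<lambda>_. {0,1}) (clifford_povm E)"
        using E S by (intro jointly_measurable_clifford_povm) blast+
    next
      assume jm: "jointly_measurable l2_space S (\<lambda>_. {0,1}) (clifford_povm E)"
      show "S \<in> E"
      proof (rule ccontr)
        assume "S \<notin> E"
        \<comment> \<open>Singletons are edges and \<open>S\<close> is nonempty, so a non-edge has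
          at least two vertices.\<close>
        moreover have "card S \<noteq> 1"
          using single S \<open>S \<notin> E\<close> by (auto simp: card_1_singleton_iff)
        moreover have "card S \<noteq> 0" using S by simp
        ultimately show False
          using jm not_jointly_measurable_clifford_povm[of S E] S by linarith
      qed
    qed
  qed (rule complex_hilbert_space_l2)
qed

end
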